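(* Let $N=d+m$. Suppose $\mathcal X^t\in\mathbb R^{p_1\times\cdots\times p_N}$ has Tucker rank $\mathbf r=(r_1,\dots,r_N)$ and $\mathcal X^*\in\mathbb R^{p_1\times\cdots\times p_N}$ has Tucker rank $\mathbf r^*=(r_1^*,\dots,r_N^* )$ with $\mathbf r^*\le\mathbf r$ entrywise. Let $\underline\lambda=\min_{k=1,\dots,N}\sigma_{r_k^*}(\mathcal M_k(\mathcal X^* ))$ and $P_{(T_{\mathcal X^t})_\perp}=I-P_{T_{\mathcal X^t}}$. Then $$\|P_{(T_{\mathcal X^t})_\perp}\mathcal X^*\|_F\le\frac{2N\|\mathcal X^t-\mathcal X^*\|_F^2}{\underline\lambda}.$$ In the matrix setting $N=2$ (with $X^t$ of rank $r$ and $X^*$ of rank $r^*\le r$), the sharper bound $\|P_{(T_{X^t})_\perp}X^*\|_F\le\frac{2\|X^t-X^*\|_F^2}{\sigma_{r^*}(X^* )}$ holds.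
   Context: $\mathcal M_k$ is the mode-$k$ matricization (columns indexed by the other modes, earlier modes varying fastest), $\mathcal T_k$ its inverse, $\times_k$ the mode-$k$ tensor–matrix product; the Tucker rank is the tuple of ranks of the matricizations; $\sigma_j(\cdot)$ is the $j$th largest singular value. For $\mathcal X$ of Tucker rank $\mathbf r$, write $\mathcal X=\mathcal S\times_1U_1\cdots\times_NU_N$ with $U_k\in\mathbb R^{p_k\times r_k}$ the matrix of the leading $r_k$ left singular vectors of $\mathcal M_k(\mathcal X)$, let $V_k$ have $r_k$ orthonormal columns spanning the row space of $\mathcal M_k(\mathcal S)$, and $W_k=(U_N\otimes\cdots\otimes U_{k+1}\otimes U_{k-1}\otimes\cdots\otimes U_1)V_k$. The orthogonal projector onto the tangent space at $\mathcal X$ of the manifold of Tucker rank-$\mathbf r$ tensors is $$P_{T_{\mathcal X}}(\mathcal Z)=\mathcal Z\times_{k=1}^NP_{U_k}+\sum_{k=1}^N\mathcal T_k\big(P_{U_{k\perp}}\mathcal M_k(\mathcal Z)P_{W_k}\big),\quad P_U=UU^\top,\ P_{U_\perp}=I-UU^\top.$$ For a rank-$r$ matrix $X=U\Sigma V^\top$ (economic SVD) this reads $P_{T_X}(Z)=P_UZP_V+P_{U_\perp}ZP_V+P_UZP_{V_\perp}$. *)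

theory Defs
  imports
    Complex_Main
    "HOL-Computational_Algebra.Polynomial"
    "Jordan_Normal_Form.DL_Rank"
    "Jordan_Normal_Form.Char_Poly"
begin

section \<open>Matrices\<close>

definition mat_rank :: "real mat \<Rightarrow> nat" where
  "mat_rank A = vec_space.rank (dim_row A) A"

definition frob_norm :: "real mat \<Rightarrow> real" where
  "frob_norm A = sqrt (\<Sum>i<dim_row A. \<Sum>j<dim_col A. (A $$ (i, j))\<^sup>2)"

text \<open>Square roots of the eigenvalues of \<open>A A\<^sup>T\<close>, in decreasing order, repeated according to
  multiplicity.\<close>

definition singular_values :: "real mat \<Rightarrow> real list" where
  "singular_values A =
     map sqrt (rev (sorted_list_of_multiset (proots (char_poly (A * A\<^sup>T)))))"

text \<open>The \<open>j\<close>th largest singular value, counting from \<open>j = 1\<close>. The value is 0 unless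
  \<open>1 \<le> j \<le> min (dim_row A) (dim_col A)\<close>.\<close>

definition sing_val :: "real mat \<Rightarrow> nat \<Rightarrow> real" where
  "sing_val A j =
     (if 1 \<le> j \<and> j \<le> min (dim_row A) (dim_col A) then singular_values A ! (j - 1) else 0)"

definition sing_diag :: "real mat \<Rightarrow> nat \<Rightarrow> real mat" where
  "sing_diag A r = mat_diag r (\<lambda>j. sing_val A (Suc j))"

definition orthonormal_cols :: "real mat \<Rightarrow> bool" where
  "orthonormal_cols U \<longleftrightarrow> U\<^sup>T * U = 1\<^sub>m (dim_col U)"

text \<open>The columns of \<open>U\<close> are left singular vectors of \<open>A\<close> for \<open>\<sigma>\<^sub>1, \<dots>, \<sigma>\<^sub>r\<close>; the columns of
  \<open>V\<close> are the matching right singular vectors: \<open>A v\<^sub>j = \<sigma>\<^sub>j u\<^sub>j\<close> and \<open>A\<^sup>T u\<^sub>j = \<sigma>\<^sub>j v\<^sub>j\<close>.\<close>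

definition leading_left_singular :: "real mat \<Rightarrow> nat \<Rightarrow> real mat \<Rightarrow> bool" where
  "leading_left_singular A r U \<longleftrightarrow>
     U \<in> carrier_mat (dim_row A) r \<and> orthonormal_cols U \<and>
     (\<exists>V \<in> carrier_mat (dim_col A) r. orthonormal_cols V \<and>
        A * V = U * sing_diag A r \<and> A\<^sup>T * U = V * sing_diag A r)"

definition economic_svd :: "real mat \<Rightarrow> nat \<Rightarrow> real mat \<Rightarrow> real mat \<Rightarrow> bool" where
  "economic_svd A r U V \<longleftrightarrow>
     U \<in> carrier_mat (dim_row A) r \<and> V \<in> carrier_mat (dim_col A) r \<and>
     orthonormal_cols U \<and> orthonormal_cols V \<and> A = U * sing_diag A r * V\<^sup>T"

definition proj :: "real mat \<Rightarrow> real mat" where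
  "proj U = U * U\<^sup>T"

definition proj_perp :: "real mat \<Rightarrow> real mat" where
  "proj_perp U = 1\<^sub>m (dim_row U) - U * U\<^sup>T"

definition kron :: "real mat \<Rightarrow> real mat \<Rightarrow> real mat" where
  "kron A B = mat (dim_row A * dim_row B) (dim_col A * dim_col B)
     (\<lambda>(i, j). A $$ (i div dim_row B, j div dim_col B) * B $$ (i mod dim_row B, j mod dim_col B))"

definition kron_list :: "real mat list \<Rightarrow> real mat" where
  "kron_list As = foldr kron As (1\<^sub>m 1)"

definition mat_tangent_proj :: "real mat \<Rightarrow> real mat \<Rightarrow> real mat \<Rightarrow> real mat" where
  "mat_tangent_proj U V Z =
     proj U * Z * proj V + proj_perp U * Z * proj V + proj U * Z * proj_perp V"


section \<open>Tensors\<close>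

text \<open>A tensor of shape \<open>p = [p\<^sub>1, \<dots>, p\<^sub>N]\<close> is a function on multi-indices (lists of
  length \<open>N\<close> with \<open>k\<close>th entry below \<open>p ! k\<close>) that is 0 on all other lists, so that equality of
  tensors is equality of functions. Modes and indices are counted from 0: mode \<open>k\<close> here is mode
  \<open>k + 1\<close> in the usual numbering.\<close>

type_synonym tensor = "nat list \<Rightarrow> real"

definition indices :: "nat list \<Rightarrow> nat list set" where
  "indices p = {i. list_all2 (<) i p}"

definition tensors :: "nat list \<Rightarrow> tensor set" where
  "tensors p = {X. \<forall>i. i \<notin> indices p \<longrightarrow> X i = 0}"

definition tensor_norm :: "nat list \<Rightarrow> tensor \<Rightarrow> real" where
  "tensor_norm p X = sqrt (\<Sum>i\<in>indices p. (X i)\<^sup>2)"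

definition del_mode :: "nat \<Rightarrow> 'a list \<Rightarrow> 'a list" where
  "del_mode k xs = take k xs @ drop (Suc k) xs"

definition ins_mode :: "nat \<Rightarrow> 'a \<Rightarrow> 'a list \<Rightarrow> 'a list" where
  "ins_mode k a xs = take k xs @ a # drop k xs"

text \<open>Linear index of a multi-index with earlier entries varying fastest, and its inverse.\<close>

fun flatten :: "nat list \<Rightarrow> nat list \<Rightarrow> nat" where
  "flatten (n # ns) (i # is) = i + n * flatten ns is"
| "flatten _ _ = 0"

fun unflatten :: "nat list \<Rightarrow> nat \<Rightarrow> nat list" where
  "unflatten [] c = []"
| "unflatten (n # ns) c = (c mod n) # unflatten ns (c div n)"

definition matricize :: "nat list \<Rightarrow> nat \<Rightarrow> tensor \<Rightarrow> real mat" where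
  "matricize p k X = mat (p ! k) (prod_list (del_mode k p))
     (\<lambda>(a, c). X (ins_mode k a (unflatten (del_mode k p) c)))"

definition tensorize :: "nat list \<Rightarrow> nat \<Rightarrow> real mat \<Rightarrow> tensor" where
  "tensorize p k A = (\<lambda>i. if i \<in> indices p
     then A $$ (i ! k, flatten (del_mode k p) (del_mode k i)) else 0)"

definition tucker_rank :: "nat list \<Rightarrow> tensor \<Rightarrow> nat list" where
  "tucker_rank p X = map (\<lambda>k. mat_rank (matricize p k X)) [0..<length p]"

definition mode_prod :: "nat list \<Rightarrow> nat \<Rightarrow> tensor \<Rightarrow> real mat \<Rightarrow> tensor" where
  "mode_prod p k X A = (\<lambda>i. if i \<in> indices (p[k := dim_row A])
     then (\<Sum>a<p ! k. A $$ (i ! k, a) * X (i[k := a])) else 0)"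

text \<open>\<open>X \<times>\<^sub>1 A\<^sub>1 \<cdots> \<times>\<^sub>n A\<^sub>n\<close> for \<open>X\<close> of shape \<open>p\<close>. After \<open>n\<close> products the first \<open>n\<close> modes have the
  sizes \<open>dim_row (A j)\<close>.\<close>

fun mode_prods :: "nat list \<Rightarrow> tensor \<Rightarrow> (nat \<Rightarrow> real mat) \<Rightarrow> nat \<Rightarrow> tensor" where
  "mode_prods p X A 0 = X"
| "mode_prods p X A (Suc n) =
     mode_prod (map (\<lambda>j. dim_row (A j)) [0..<n] @ drop n p) n (mode_prods p X A n) (A n)"

text \<open>\<open>S\<close>, \<open>U\<close> and \<open>V\<close> are the data from which the tangent space at \<open>X\<close> is described, where
  \<open>X\<close> has shape \<open>p\<close> and Tucker rank \<open>r\<close>: the decomposition \<open>X = S \<times>\<^sub>1 U\<^sub>1 \<cdots> \<times>\<^sub>N U\<^sub>N\<close> with leading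
  left singular vectors, and orthonormal bases \<open>V k\<close> of the row spaces of the core.\<close>

definition tucker_frame ::
  "nat list \<Rightarrow> nat list \<Rightarrow> tensor \<Rightarrow> tensor \<Rightarrow> (nat \<Rightarrow> real mat) \<Rightarrow> (nat \<Rightarrow> real mat) \<Rightarrow> bool" where
  "tucker_frame p r X S U V \<longleftrightarrow>
     (\<forall>k<length p. leading_left_singular (matricize p k X) (r ! k) (U k)) \<and>
     S \<in> tensors r \<and>
     X = mode_prods r S U (length p) \<and>
     (\<forall>k<length p.
        let n = prod_list (del_mode k r) in
        V k \<in> carrier_mat n (r ! k) \<and> orthonormal_cols (V k) \<and>
        vec_space.col_space n (V k) = vec_space.row_space n (matricize r k S))"

definition tangent_W :: "nat \<Rightarrow> (nat \<Rightarrow> real mat) \<Rightarrow> (nat \<Rightarrow> real mat) \<Rightarrow> nat \<Rightarrow> real mat" where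
  "tangent_W N U V k = kron_list (map U (rev (del_mode k [0..<N]))) * V k"

definition tangent_proj ::
  "nat list \<Rightarrow> (nat \<Rightarrow> real mat) \<Rightarrow> (nat \<Rightarrow> real mat) \<Rightarrow> tensor \<Rightarrow> tensor" where
  "tangent_proj p U V Z = (\<lambda>i.
     mode_prods p Z (\<lambda>k. proj (U k)) (length p) i +
     (\<Sum>k<length p. tensorize p k
        (proj_perp (U k) * matricize p k Z * proj (tangent_W (length p) U V k)) i))"

end

theory Submission
  imports Defs "Jordan_Normal_Form.Spectral_Radius" "HOL-Analysis.L2_Norm"
begin

text \<open>
  The residual of the tangent space projection is a sum over the modes of terms \<open>P Z R\<close>, where \<open>Z\<close> is
  a matricization of \<open>X\<^sup>*\<close> and \<open>P\<close>, \<open>R\<close> are orthogonal projectors with \<open>P X = 0\<close> and \<open>X R = 0\<close> for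
  the corresponding matricization \<open>X\<close> of \<open>X\<^sup>t\<close>. Writing \<open>Z = Z Z\<^sup>+ Z\<close> with the pseudoinverse, whose
  operator norm is the reciprocal of the smallest nonzero singular value \<open>\<sigma>\<close> of \<open>Z\<close>, gives
  \<open>\<parallel>P Z R\<parallel> \<le> \<parallel>P Z\<parallel> \<parallel>Z R\<parallel> / \<sigma> = \<parallel>P (Z - X)\<parallel> \<parallel>(Z - X) R\<parallel> / \<sigma> \<le> \<parallel>X - Z\<parallel>\<^sup>2 / \<sigma>\<close>.
  A matrix has one such term and a tensor has one per mode.
\<close>

section \<open>The real spectral theorem\<close>

text \<open>For tensors the projector \<open>R\<close> depends on the mode. Passing from
  \<open>Z\<close> to its projection in all modes, one mode at a time, leaves at mode
  \<open>k\<close> the left factor \<open>proj_perp (U k)\<close> and, on the columns, the Kronecker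
  product \<open>Q k\<close> of projectors in the modes before \<open>k\<close> and identities in
  the modes after it. Subtracting the matching summand of the tangent projection turns
  \<open>Q k\<close> into \<open>R = Q k - proj (W k)\<close>. This is an orthogonal projector
  because \<open>Q k\<close> fixes every column of \<open>W k\<close>, and it annihilates the
  matricization of \<open>Xt\<close> because \<open>Q k\<close> and \<open>proj (W k)\<close> both
  fix its rows. One term per mode yields the constants \<open>N\<close> for tensors and 1 for
  matrices, half of those stated. Singular values are defined through roots of a characteristic
  polynomial, so the estimate rests on a spectral theorem for real symmetric matrices; a thin
  factorization \<open>A = C * B\<close> then does the work of the pseudoinverse. If
  \<open>Xs = 0\<close>, the divisor takes the default value 0, division by 0 yields 0, and the
  residual vanishes as well.\<close>

lemma assoc_mult_mat_dim:
  "dim_col A = dim_row B \<Longrightarrow> dim_col B = dim_row C \<Longrightarrow> (A * B) * C = A * (B * (C::real mat))"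
  by (rule assoc_mult_mat[of _ "dim_row A" "dim_row B" _ "dim_row C" _ "dim_col C"]) auto

lemma transpose_mult_dim:
  "dim_col A = dim_row B \<Longrightarrow> (A * B)\<^sup>T = B\<^sup>T * (A\<^sup>T::real mat)"
  by (rule transpose_mult[of _ "dim_row A" "dim_row B" _ "dim_col B"]) auto

lemma symmetric_index:
  assumes "M\<^sup>T = (M::real mat)" "i < dim_row M" "j < dim_row M"
  shows "M $$ (i, j) = M $$ (j, i)"
  using assms by (metis index_transpose_mat(1) index_transpose_mat(3))

lemma mult_mat_vec_index:
  assumes "A \<in> carrier_mat m n" "x \<in> carrier_vec n" "i < m"
  shows "(A *\<^sub>v x) $ i = (\<Sum>j<n. A $$ (i, j) * x $ j)"
  using assms by (auto simp: scalar_prod_def row_def atLeast0LessThan intro!: sum.cong)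

lemma mult_mat_index:
  assumes "i < dim_row A" "j < dim_col B" "dim_col A = dim_row B"
  shows "(A * B) $$ (i, j) = (\<Sum>k<dim_row B. A $$ (i, k) * B $$ (k, j))"
  using assms by (auto simp: scalar_prod_def row_def atLeast0LessThan intro!: sum.cong)

text \<open>Some complex eigenvector \<open>z = x + i y\<close> exists. Symmetry gives
  \<open>x . M y = y . M x\<close>, which reduces to \<open>Im e * |z|^2 = 0\<close>. The eigenvalue
  is then real, and whichever of \<open>x\<close> and \<open>y\<close> is nonzero is a real
  eigenvector.\<close>

lemma symmetric_unit_eigenvector:
  fixes M :: "real mat"
  assumes M: "M \<in> carrier_mat n n" and sym: "M\<^sup>T = M" and n: "n > 0"
  obtains v k where "v \<in> carrier_vec n" "v \<bullet> v = 1" "M *\<^sub>v v = k \<cdot>\<^sub>v v"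
proof -
  let ?C = "map_mat complex_of_real M"
  have C: "?C \<in> carrier_mat n n" using M by simp
  obtain e where "eigenvalue ?C e"
    using spectrum_non_empty[OF C n] by (auto simp: spectrum_def)
  then obtain z where z: "z \<in> carrier_vec n" "z \<noteq> 0\<^sub>v n" "?C *\<^sub>v z = e \<cdot>\<^sub>v z"
    using M by (auto simp: eigenvalue_def eigenvector_def)
  define x where "x = (\<lambda>i. Re (z $ i))"
  define y where "y = (\<lambda>i. Im (z $ i))"
  have row: "(\<Sum>j<n. complex_of_real (M $$ (i, j)) * z $ j) = e * z $ i" if "i < n" for i
  proof -
    have "(\<Sum>j<n. complex_of_real (M $$ (i, j)) * z $ j) = (\<Sum>j<n. ?C $$ (i, j) * z $ j)"
      using M that by (intro sum.cong) auto
    also have "\<dots> = (?C *\<^sub>v z) $ i" using mult_mat_vec_index[OF C z(1) that] by simp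
    finally show ?thesis using z that by simp
  qed
  have Mx: "(\<Sum>j<n. M $$ (i, j) * x j) = Re e * x i - Im e * y i" if "i < n" for i
    using arg_cong[OF row[OF that], of Re] by (simp add: x_def y_def)
  have My: "(\<Sum>j<n. M $$ (i, j) * y j) = Re e * y i + Im e * x i" if "i < n" for i
    using arg_cong[OF row[OF that], of Im] by (simp add: x_def y_def)
  have "(\<Sum>i<n. x i * (\<Sum>j<n. M $$ (i, j) * y j)) = (\<Sum>i<n. \<Sum>j<n. y j * (M $$ (j, i) * x i))"
    unfolding sum_distrib_left using symmetric_index[OF sym] M
    by (intro sum.cong refl) (auto simp: mult_ac)
  also have "\<dots> = (\<Sum>i<n. y i * (\<Sum>j<n. M $$ (i, j) * x j))"
    by (subst sum.swap) (simp add: sum_distrib_left)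
  finally have "(\<Sum>i<n. x i * (Re e * y i + Im e * x i)) = (\<Sum>i<n. y i * (Re e * x i - Im e * y i))"
    by (simp add: Mx My)
  then have "(\<Sum>i<n. x i * (Re e * y i + Im e * x i) - y i * (Re e * x i - Im e * y i)) = 0"
    by (simp add: sum_subtractf)
  then have "Im e * (\<Sum>i<n. (x i)\<^sup>2 + (y i)\<^sup>2) = 0"
    by (simp add: sum_distrib_left algebra_simps power2_eq_square)
  moreover obtain i where i: "i < n" "z $ i \<noteq> 0"
    using z(1,2) by (metis carrier_vecD eq_vecI index_zero_vec(1) index_zero_vec(2))
  then have "0 < (x i)\<^sup>2 + (y i)\<^sup>2"
    by (metis x_def y_def complex_eq_0 less_eq_real_def sum_power2_ge_zero)
  then have "0 < (\<Sum>i<n. (x i)\<^sup>2 + (y i)\<^sup>2)"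
    using i(1) by (intro sum_pos2[of _ i]) auto
  ultimately have im: "Im e = 0" by simp
  have "x i \<noteq> 0 \<or> y i \<noteq> 0" using i(2) by (auto simp: x_def y_def complex_eq_iff)
  then have "\<exists>w. (\<forall>i<n. (\<Sum>j<n. M $$ (i, j) * w j) = Re e * w i) \<and> w i \<noteq> 0"
  proof
    assume "x i \<noteq> 0"
    then show ?thesis using Mx im by (intro exI[of _ x]) simp
  next
    assume "y i \<noteq> 0"
    then show ?thesis using My im by (intro exI[of _ y]) simp
  qed
  then obtain w where w: "\<And>i. i < n \<Longrightarrow> (\<Sum>j<n. M $$ (i, j) * w j) = Re e * w i" "w i \<noteq> 0"
    by blast
  define s where "s = sqrt (\<Sum>i<n. (w i)\<^sup>2)"
  have "(\<Sum>i<n. (w i)\<^sup>2) > 0" using i(1) w(2) by (intro sum_pos2[of _ i]) auto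
  then have s: "s > 0" "s\<^sup>2 = (\<Sum>i<n. (w i)\<^sup>2)" by (auto simp: s_def)
  define v where "v = vec n (\<lambda>i. w i / s)"
  show thesis
  proof
    show v: "v \<in> carrier_vec n" by (simp add: v_def)
    have "v \<bullet> v = (\<Sum>i<n. (w i)\<^sup>2 / s\<^sup>2)"
      by (simp add: v_def scalar_prod_def atLeast0LessThan power2_eq_square)
    then show "v \<bullet> v = 1" using s(1) by (simp add: sum_divide_distrib[symmetric] s(2)[symmetric])
    show "M *\<^sub>v v = Re e \<cdot>\<^sub>v v"
    proof (rule eq_vecI)
      fix i assume "i < dim_vec (Re e \<cdot>\<^sub>v v)"
      then have i: "i < n" using v by simp
      have "(M *\<^sub>v v) $ i = (\<Sum>j<n. M $$ (i, j) * v $ j)" by (rule mult_mat_vec_index[OF M v i])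
      also have "\<dots> = (\<Sum>j<n. M $$ (i, j) * w j) / s"
        by (simp add: v_def sum_divide_distrib)
      finally show "(M *\<^sub>v v) $ i = (Re e \<cdot>\<^sub>v v) $ i" using i w(1) by (simp add: v_def)
    qed (use M v in simp)
  qed
qed

text \<open>Supplies the change of basis for deflation. As a symmetric involution, \<open>H\<close>
  is its own transpose and inverse, so conjugating by it preserves symmetry.\<close>

lemma orthogonal_mat_with_first_col:
  fixes v :: "real vec"
  assumes v: "v \<in> carrier_vec n" "v \<bullet> v = 1" and n: "n > 0"
  obtains H where "H \<in> carrier_mat n n" "H\<^sup>T = H" "H * H = 1\<^sub>m n" "col H 0 = v"
proof (cases "v = unit_vec n 0")
  \<comment> \<open>The reflection vector would be zero here, and the identity already has the
    required first column.\<close>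
  case True
  then show thesis using n by (intro that[of "1\<^sub>m n"]) auto
next
  case False
  \<comment> \<open>The Householder reflection that exchanges \<open>v\<close> and the first unit vector.\<close>
  define w where "w = (\<lambda>i. v $ i - (if i = 0 then 1 else 0))"
  define c where "c = (\<Sum>i<n. (w i)\<^sup>2)"
  have vv: "(\<Sum>i<n. (v $ i)\<^sup>2) = 1"
    using v by (simp add: scalar_prod_def atLeast0LessThan power2_eq_square)
  have "c = (\<Sum>i<n. (v $ i)\<^sup>2 + (if i = 0 then 1 - 2 * v $ i else 0))"
    unfolding c_def w_def by (intro sum.cong) (auto simp: power2_eq_square algebra_simps)
  also have "\<dots> = 2 - 2 * v $ 0" using n vv by (simp add: sum.distrib)
  finally have c: "c = 2 - 2 * v $ 0" .
  obtain i where i: "i < n" "v $ i \<noteq> unit_vec n 0 $ i"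
    using False v(1) by (metis carrier_vecD eq_vecI index_unit_vec(3))
  then have "w i \<noteq> 0" by (auto simp: w_def)
  then have c0: "c > 0" unfolding c_def using i(1) by (intro sum_pos2[of _ i]) auto
  define H where "H = mat n n (\<lambda>(i, j). (if i = j then 1 else 0) - 2 / c * w i * w j)"
  show thesis
  proof
    show H: "H \<in> carrier_mat n n" by (simp add: H_def)
    show "H\<^sup>T = H" by (rule eq_matI) (auto simp: H_def)
    show "H * H = 1\<^sub>m n"
    proof (rule eq_matI)
      fix i j assume "i < dim_row (1\<^sub>m n :: real mat)" "j < dim_col (1\<^sub>m n :: real mat)"
      then have ij: "i < n" "j < n" by auto
      have "(H * H) $$ (i, j) = (\<Sum>k<n. ((if i = k then 1 else 0) - 2 / c * w i * w k)
          * ((if k = j then 1 else 0) - 2 / c * w k * w j))"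
        using ij by (subst mult_mat_index) (auto simp: H_def intro!: sum.cong)
      also have "\<dots> = (\<Sum>k<n. (if k = i then (if i = j then 1 else 0) - 2 / c * w i * w j else 0)
          - (if k = j then 2 / c * w i * w j else 0) + (2 / c)\<^sup>2 * w i * w j * (w k)\<^sup>2)"
        by (intro sum.cong) (auto simp: power2_eq_square algebra_simps)
      also have "\<dots> = (if i = j then 1 else 0) - 4 / c * w i * w j + (2 / c)\<^sup>2 * w i * w j * c"
        using ij by (simp add: sum.distrib sum_subtractf sum_distrib_left[symmetric] c_def)
      also have "\<dots> = 1\<^sub>m n $$ (i, j)" using ij c0 by (simp add: power2_eq_square)
      finally show "(H * H) $$ (i, j) = 1\<^sub>m n $$ (i, j)" .
    qed (use H in auto)
    \<comment> \<open>Since \<open>c = 2 - 2 * v $ 0 = - 2 * w 0\<close>, column 0 of the reflection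
      is the first unit vector plus \<open>w\<close>, which is \<open>v\<close>.\<close>
    have w0: "2 / c * w i * w 0 = - w i" for i
    proof -
      have "w 0 = - c / 2" by (simp add: w_def c)
      then show ?thesis using c0 by simp
    qed
    show "col H 0 = v"
      by (rule eq_vecI) (use v n in \<open>auto simp: H_def w0 simp del: times_divide_eq_left, auto simp: w_def\<close>)
  qed
qed

text \<open>Deflation: conjugating by a reflection whose first column is a unit eigenvector makes
  the first column of \<open>M'\<close> a multiple of the first unit vector. By symmetry the first
  row is too, so \<open>M'\<close> is block diagonal and the induction hypothesis applies to the
  lower block \<open>N\<close>.\<close>

theorem real_spectral_theorem:
  fixes M :: "real mat"
  assumes "M \<in> carrier_mat n n" "M\<^sup>T = M"
  obtains Q d where "Q \<in> carrier_mat n n" "Q\<^sup>T * Q = 1\<^sub>m n" "M * Q = Q * mat_diag n d"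
proof -
  have "\<exists>Q d. Q \<in> carrier_mat n n \<and> Q\<^sup>T * Q = 1\<^sub>m n \<and> M * Q = Q * mat_diag n d"
    using assms
  proof (induction n arbitrary: M)
    case 0
    then show ?case
      by (intro exI[of _ "1\<^sub>m 0"] exI[of _ "\<lambda>_. 0"]) (auto simp: mat_diag_def)
  next
    case (Suc n M)
    note M = Suc.prems(1) and sym = Suc.prems(2)
    obtain v k where v: "v \<in> carrier_vec (Suc n)" "v \<bullet> v = 1" "M *\<^sub>v v = k \<cdot>\<^sub>v v"
      using symmetric_unit_eigenvector[OF M sym] by blast
    obtain H where H: "H \<in> carrier_mat (Suc n) (Suc n)" "H\<^sup>T = H" "H * H = 1\<^sub>m (Suc n)" "col H 0 = v"
      using orthogonal_mat_with_first_col[OF v(1,2)] by blast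
    define M' where "M' = H * M * H"
    have M': "M' \<in> carrier_mat (Suc n) (Suc n)" using H M by (auto simp: M'_def)
    have sym': "M'\<^sup>T = M'"
      using H M sym by (simp add: M'_def transpose_mult_dim assoc_mult_mat_dim)
    have "col M' 0 = H *\<^sub>v (M *\<^sub>v v)"
      unfolding M'_def col_mult2[OF mult_carrier_mat[OF H(1) M] H(1) zero_less_Suc] H(4)
      by (rule assoc_mult_mat_vec[OF H(1) M v(1)])
    also have "\<dots> = k \<cdot>\<^sub>v col (H * H) 0"
      unfolding v(3) mult_mat_vec[OF H(1) v(1)] col_mult2[OF H(1) H(1) zero_less_Suc] H(4) ..
    finally have col0: "col M' 0 = k \<cdot>\<^sub>v unit_vec (Suc n) 0" using H(3) by simp
    have M'0: "M' $$ (i, 0) = (if i = 0 then k else 0)" if "i < Suc n" for i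
      using arg_cong[OF col0, of "\<lambda>v. v $ i"] M' that by simp
    have M'0': "M' $$ (0, i) = (if i = 0 then k else 0)" if "i < Suc n" for i
      using symmetric_index[OF sym', of 0 i] M'0[OF that] M' that by simp
    define N where "N = mat n n (\<lambda>(i, j). M' $$ (Suc i, Suc j))"
    have N: "N \<in> carrier_mat n n" by (simp add: N_def)
    have "N\<^sup>T = N"
      using symmetric_index[OF sym'] M' by (intro eq_matI) (auto simp: N_def)
    from Suc.IH[OF N this] obtain P d where P: "P \<in> carrier_mat n n" "P\<^sup>T * P = 1\<^sub>m n"
      "N * P = P * mat_diag n d" by blast
    define d' where "d' = (\<lambda>i. case i of 0 \<Rightarrow> k | Suc i \<Rightarrow> d i)"
    let ?b = "\<lambda>A B. four_block_mat A (0\<^sub>m 1 n) (0\<^sub>m n 1) (B::real mat)"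
    let ?k = "mat_diag 1 (\<lambda>_. k)"
    have Mb: "M' = ?b ?k N"
      using M' M'0 M'0' by (intro eq_matI) (auto simp: N_def mat_diag_def)
    have Db: "mat_diag (Suc n) d' = ?b ?k (mat_diag n d)"
      by (intro eq_matI) (auto simp: mat_diag_def d'_def split: nat.splits)
    define Q where "Q = ?b (1\<^sub>m 1) P"
    have Q: "Q \<in> carrier_mat (Suc n) (Suc n)"
      using P four_block_carrier_mat[of "1\<^sub>m 1" 1 1 P n n] by (simp add: Q_def)
    have QT: "Q\<^sup>T = ?b (1\<^sub>m 1) P\<^sup>T"
      unfolding Q_def by (subst transpose_four_block_mat[of _ 1 1 _ n _ n]) (use P in auto)
    have QQ: "Q\<^sup>T * Q = 1\<^sub>m (Suc n)"
      unfolding QT unfolding Q_def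
      by (subst mult_four_block_mat[of _ 1 1 _ n _ n _ _ 1 _ n]) (use P in auto)
    have "M' * Q = ?b ?k (N * P)"
      unfolding Mb Q_def by (subst mult_four_block_mat[of _ 1 1 _ n _ n _ _ 1 _ n])
        (use P N right_mult_one_mat[OF mat_diag_dim[of 1 "\<lambda>_. k"]]
          right_mult_zero_mat[OF mat_diag_dim[of 1 "\<lambda>_. k"], of n] in auto)
    moreover have "Q * mat_diag (Suc n) d' = ?b ?k (P * mat_diag n d)"
      unfolding Db Q_def by (subst mult_four_block_mat[of _ 1 1 _ n _ n _ _ 1 _ n])
        (use P N left_mult_one_mat[OF mat_diag_dim[of 1 "\<lambda>_. k"]]
          left_mult_zero_mat[OF mat_diag_dim[of 1 "\<lambda>_. k"], of n]
          left_mult_zero_mat[OF mat_diag_dim[of n d], of 1] in auto)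
    ultimately have MQ: "M' * Q = Q * mat_diag (Suc n) d'" using P by simp
    show ?case
    proof (intro exI conjI)
      show "H * Q \<in> carrier_mat (Suc n) (Suc n)" using H Q by simp
      have "(H * Q)\<^sup>T * (H * Q) = Q\<^sup>T * (H * H) * Q"
        using H(1,2) Q by (simp add: transpose_mult_dim assoc_mult_mat_dim)
      then show "(H * Q)\<^sup>T * (H * Q) = 1\<^sub>m (Suc n)" using H Q QQ by simp
      have "M * (H * Q) = (H * H) * M * (H * Q)" using H(3) M by simp
      also have "\<dots> = H * (M' * Q)"
        unfolding M'_def using H(1) M Q by (simp add: assoc_mult_mat_dim)
      also have "\<dots> = H * Q * mat_diag (Suc n) d'"
        unfolding MQ using H(1) Q by (simp add: assoc_mult_mat_dim mat_diag_def)
      finally show "M * (H * Q) = H * Q * mat_diag (Suc n) d'" .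
    qed
  qed
  then show thesis using that by blast
qed


section \<open>Frobenius norm and singular values\<close>

text \<open>The squared norm is the trace of \<open>A * A\<^sup>T\<close>, so comparisons of norms
  become identities between Gram matrices.\<close>

lemma frob_norm_sq: "(frob_norm A)\<^sup>2 = (\<Sum>i<dim_row A. (A * A\<^sup>T) $$ (i, i))"
proof -
  have "(frob_norm A)\<^sup>2 = (\<Sum>i<dim_row A. \<Sum>j<dim_col A. (A $$ (i, j))\<^sup>2)"
    unfolding frob_norm_def by (intro real_sqrt_pow2 sum_nonneg) auto
  also have "\<dots> = (\<Sum>i<dim_row A. (A * A\<^sup>T) $$ (i, i))"
    by (intro sum.cong refl) (simp add: mult_mat_index power2_eq_square del: index_mult_mat(1))
  finally show ?thesis .
qed

lemma frob_norm_nonneg: "0 \<le> frob_norm A"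
  unfolding frob_norm_def by (intro real_sqrt_ge_zero sum_nonneg) auto

lemma frob_norm_transpose: "frob_norm A\<^sup>T = frob_norm A"
  unfolding frob_norm_def by (subst sum.swap) simp

text \<open>Cauchy-Schwarz for each row of \<open>A\<close> against each column of
  \<open>B\<close>.\<close>

lemma frob_norm_mult:
  assumes "dim_col A = dim_row B"
  shows "frob_norm (A * B) \<le> frob_norm A * frob_norm B"
proof -
  let ?n = "dim_row B"
  define a where "a = (\<lambda>i. \<Sum>k<?n. (A $$ (i, k))\<^sup>2)"
  define b where "b = (\<lambda>j. \<Sum>k<?n. (B $$ (k, j))\<^sup>2)"
  have "((A * B) $$ (i, j))\<^sup>2 \<le> a i * b j" if "i < dim_row A" "j < dim_col B" for i j
  proof -
    have "\<bar>(A * B) $$ (i, j)\<bar> \<le> (\<Sum>k<?n. \<bar>A $$ (i, k)\<bar> * \<bar>B $$ (k, j)\<bar>)"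
      using that assms sum_abs[of "\<lambda>k. A $$ (i, k) * B $$ (k, j)" "{..<?n}"]
      by (simp add: mult_mat_index abs_mult del: index_mult_mat(1))
    also have "\<dots> \<le> sqrt (a i) * sqrt (b j)"
      using L2_set_mult_ineq[of "\<lambda>k. A $$ (i, k)" "\<lambda>k. B $$ (k, j)" "{..<?n}"]
      by (simp add: L2_set_def a_def b_def)
    finally have "\<bar>(A * B) $$ (i, j)\<bar>\<^sup>2 \<le> (sqrt (a i) * sqrt (b j))\<^sup>2"
      by (intro power_mono) auto
    then show ?thesis
      by (simp add: power_mult_distrib a_def b_def sum_nonneg)
  qed
  then have "(\<Sum>i<dim_row A. \<Sum>j<dim_col B. ((A * B) $$ (i, j))\<^sup>2)
      \<le> (\<Sum>i<dim_row A. \<Sum>j<dim_col B. a i * b j)"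
    by (intro sum_mono) auto
  also have "\<dots> = (\<Sum>i<dim_row A. a i) * (\<Sum>j<dim_col B. b j)"
    by (simp add: sum_product)
  finally have "frob_norm (A * B) \<le> sqrt ((\<Sum>i<dim_row A. a i) * (\<Sum>j<dim_col B. b j))"
    by (simp add: frob_norm_def del: index_mult_mat(1))
  also have "(\<Sum>j<dim_col B. b j) = (\<Sum>i<?n. \<Sum>j<dim_col B. (B $$ (i, j))\<^sup>2)"
    unfolding b_def by (rule sum.swap)
  finally show ?thesis using assms by (simp add: frob_norm_def a_def real_sqrt_mult)
qed

text \<open>Orthonormal columns leave \<open>Z\<^sup>T * Z\<close> unchanged; the norms are taken of
  transposes so that this is the Gram matrix in \<open>frob_norm_sq\<close>.\<close>

lemma frob_norm_orthonormal_mult: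
  assumes "orthonormal_cols C" "dim_col C = dim_row Z"
  shows "frob_norm (C * Z) = frob_norm Z"
proof -
  have "(C * Z)\<^sup>T * (C * Z) = Z\<^sup>T * (C\<^sup>T * C) * Z"
    using assms(2) by (simp add: transpose_mult_dim assoc_mult_mat_dim)
  also have "\<dots> = Z\<^sup>T * Z"
    using assms by (simp add: orthonormal_cols_def)
  finally have "(frob_norm (C * Z)\<^sup>T)\<^sup>2 = (frob_norm Z\<^sup>T)\<^sup>2"
    by (simp add: frob_norm_sq)
  then show ?thesis by (simp add: frob_norm_transpose frob_norm_nonneg)
qed

text \<open>Pythagoras with the complementary projector \<open>S\<close>: the Gram matrix of
  \<open>Z\<close> is the sum of those of \<open>Z * R\<close> and \<open>Z * S\<close>, and the
  second has nonnegative trace.\<close>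

lemma frob_norm_mult_projection_right:
  assumes R: "R \<in> carrier_mat n n" "R\<^sup>T = R" "R * R = R" and Z: "dim_col Z = n"
  shows "frob_norm (Z * R) \<le> frob_norm Z"
proof -
  define S where "S = 1\<^sub>m n - R"
  have S: "S \<in> carrier_mat n n" using R(1) by (simp add: S_def minus_carrier_mat)
  have ST: "S\<^sup>T = S" using R(1,2) transpose_minus[of "1\<^sub>m n" n n R] by (simp add: S_def)
  have "S * S = (1\<^sub>m n - R) - (R - R * R)"
    unfolding S_def using R(1) minus_mult_distrib_mat[of "1\<^sub>m n" n n R "1\<^sub>m n - R" n]
      mult_minus_distrib_mat[of R n n "1\<^sub>m n" n R] by (simp add: minus_carrier_mat)
  also have "\<dots> = 1\<^sub>m n - R"
    unfolding R(3) by (rule eq_matI) (use carrier_matD[OF R(1)] in auto)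
  finally have SS: "S * S = S" unfolding S_def .
  have eq: "(Z * T) * (Z * T)\<^sup>T = Z * T * Z\<^sup>T"
    if T: "T \<in> carrier_mat n n" "T\<^sup>T = T" "T * T = T" for T
  proof -
    have "(Z * T) * (Z * T)\<^sup>T = Z * (T * T) * Z\<^sup>T"
      using T(1,2) Z by (simp add: transpose_mult_dim assoc_mult_mat_dim)
    then show ?thesis using T(3) by simp
  qed
  have c: "Z \<in> carrier_mat (dim_row Z) n" using Z by auto
  have "R + S = 1\<^sub>m n" using R(1) by (intro eq_matI) (auto simp: S_def)
  then have "Z * Z\<^sup>T = Z * (R + S) * Z\<^sup>T" using right_mult_one_mat[OF c] by (simp only:)
  also have "\<dots> = Z * R * Z\<^sup>T + Z * S * Z\<^sup>T"
    unfolding mult_add_distrib_mat[OF c R(1) S]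
    by (rule add_mult_distrib_mat[of _ "dim_row Z" n]) (use Z R(1) S in auto)
  finally have sum: "Z * Z\<^sup>T = (Z * R) * (Z * R)\<^sup>T + (Z * S) * (Z * S)\<^sup>T"
    unfolding eq[OF R] eq[OF S ST SS] .
  have "(frob_norm Z)\<^sup>2 = (\<Sum>i<dim_row Z.
      ((Z * R) * (Z * R)\<^sup>T) $$ (i, i) + ((Z * S) * (Z * S)\<^sup>T) $$ (i, i))"
    unfolding frob_norm_sq sum
    by (rule sum.cong[OF refl], rule index_add_mat(1)) auto
  then have "(frob_norm Z)\<^sup>2 = (frob_norm (Z * R))\<^sup>2 + (frob_norm (Z * S))\<^sup>2"
    unfolding frob_norm_sq index_mult_mat(2) sum.distrib .
  then have "(frob_norm (Z * R))\<^sup>2 \<le> (frob_norm Z)\<^sup>2" by simp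
  then show ?thesis using power2_le_imp_le frob_norm_nonneg by blast
qed

lemma frob_norm_mult_projection_left:
  assumes R: "R \<in> carrier_mat n n" "R\<^sup>T = R" "R * R = R" and Z: "dim_row Z = n"
  shows "frob_norm (R * Z) \<le> frob_norm Z"
  using frob_norm_mult_projection_right[OF R, of "Z\<^sup>T"] Z R(1,2)
  by (metis carrier_matD(2) frob_norm_transpose index_transpose_mat(3) transpose_mult_dim)

section \<open>Ordered eigenvalues, rank and the thin singular value decomposition\<close>

lemma sorted_real_spectral_theorem:
  fixes M :: "real mat"
  assumes M: "M \<in> carrier_mat n n" "M\<^sup>T = M"
  obtains Q d where "Q \<in> carrier_mat n n" "Q\<^sup>T * Q = 1\<^sub>m n" "M * Q = Q * mat_diag n d"
    "\<And>i j. i \<le> j \<Longrightarrow> j < n \<Longrightarrow> d j \<le> d i"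
proof -
  obtain Q d where Q: "Q \<in> carrier_mat n n" "Q\<^sup>T * Q = 1\<^sub>m n" "M * Q = Q * mat_diag n d"
    using real_spectral_theorem[OF M] .
  \<comment> \<open>\<open>sort_key\<close> lists the indices by increasing eigenvalue; the reversed
    list is the column permutation that gives the decreasing order used by
    \<open>singular_values\<close>.\<close>
  define f where "f = (!) (rev (sort_key d [0..<n]))"
  have sorted: "sorted (map d (sort_key d [0..<n]))" by simp
  have f: "f i < n" if "i < n" for i
    using nth_mem[of i "rev (sort_key d [0..<n])"] that by (simp add: f_def)
  have inj: "f i = f j \<longleftrightarrow> i = j" if "i < n" "j < n" for i j
    using that by (simp add: f_def nth_eq_iff_index_eq)
  define Q' where "Q' = mat n n (\<lambda>(i, j). Q $$ (i, f j))"
  show thesis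
  proof
    show Q': "Q' \<in> carrier_mat n n" by (simp add: Q'_def)
    show "Q'\<^sup>T * Q' = 1\<^sub>m n"
    proof (rule eq_matI)
      fix i j assume "i < dim_row (1\<^sub>m n :: real mat)" "j < dim_col (1\<^sub>m n :: real mat)"
      then have ij: "i < n" "j < n" by auto
      have "(Q'\<^sup>T * Q') $$ (i, j) = (\<Sum>k<n. Q $$ (k, f i) * Q $$ (k, f j))"
        using ij by (subst mult_mat_index) (auto simp: Q'_def)
      also have "\<dots> = (Q\<^sup>T * Q) $$ (f i, f j)"
        using ij f Q(1) by (subst mult_mat_index) auto
      finally show "(Q'\<^sup>T * Q') $$ (i, j) = 1\<^sub>m n $$ (i, j)"
        using ij f inj Q(2) by simp
    qed (use Q' in auto)
    show "M * Q' = Q' * mat_diag n (d \<circ> f)"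
    proof (rule eq_matI)
      fix i j assume "i < dim_row (Q' * mat_diag n (d \<circ> f))" "j < dim_col (Q' * mat_diag n (d \<circ> f))"
      then have ij: "i < n" "j < n" using Q' by (auto simp: mat_diag_def)
      have "(M * Q') $$ (i, j) = (\<Sum>k<n. M $$ (i, k) * Q $$ (k, f j))"
        using ij M by (subst mult_mat_index) (auto simp: Q'_def)
      also have "\<dots> = (M * Q) $$ (i, f j)"
        using ij f Q(1) M by (subst mult_mat_index) auto
      finally show "(M * Q') $$ (i, j) = (Q' * mat_diag n (d \<circ> f)) $$ (i, j)"
        using ij f unfolding Q(3) mat_diag_mult_right[OF Q(1)] mat_diag_mult_right[OF Q']
        by (simp add: Q'_def)
    qed (use Q' M in \<open>auto simp: mat_diag_def\<close>)
    show "(d \<circ> f) j \<le> (d \<circ> f) i" if "i \<le> j" "j < n" for i j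
      using sorted_nth_mono[OF sorted, of "n - Suc j" "n - Suc i"] that
      by (simp add: f_def rev_nth)
  qed
qed

text \<open>Each matrix factors through the other, so their column spaces agree. This is how the
  rank of \<open>A\<close> is read off from a factor with orthonormal columns.\<close>

lemma mat_rank_cong:
  fixes X Y :: "real mat"
  assumes "X \<in> carrier_mat m a" "Y \<in> carrier_mat m b" "Z \<in> carrier_mat b a" "W \<in> carrier_mat a b"
    and XY: "X = Y * Z" "Y = X * W"
  shows "mat_rank X = mat_rank Y"
proof -
  interpret vec_space "TYPE(real)" m .
  have sub: "col_space X \<subseteq> col_space Y"
    if "X \<in> carrier_mat m a" "Y \<in> carrier_mat m b" "Z \<in> carrier_mat b a" "X = Y * Z" for X Y Z a b
  proof -
    have "X *\<^sub>v x = Y *\<^sub>v (Z *\<^sub>v x)" if "x \<in> carrier_vec a" for x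
      using \<open>X = Y * Z\<close> \<open>Y \<in> _\<close> \<open>Z \<in> _\<close> that by (simp add: assoc_mult_mat_vec[of _ m b _ a])
    then show ?thesis
      unfolding col_space_eq[OF that(1)] col_space_eq[OF that(2)]
      using that(1-3) mult_mat_vec_carrier[OF that(3)] by (auto 4 4)
  qed
  have "col_space X = col_space Y"
    using sub[OF assms(1-3) XY(1)] sub[OF assms(2,1,4) XY(2)] by blast
  then show ?thesis
    using assms(1,2) unfolding mat_rank_def vec_space.rank_def col_space_def by simp
qed

lemma mat_rank_orthonormal_cols:
  assumes C: "C \<in> carrier_mat m c" "orthonormal_cols C"
  shows "mat_rank C = c"
proof -
  interpret vec_space "TYPE(real)" m .
  have CC: "C\<^sup>T * C = 1\<^sub>m c" using C by (simp add: orthonormal_cols_def)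
  have scalar: "col C i \<bullet> col C j = (if i = j then 1 else 0)" if "i < c" "j < c" for i j
    using arg_cong[OF CC, of "\<lambda>M. M $$ (i, j)"] that C(1) by simp
  have dist: "distinct (cols C)"
    unfolding distinct_conv_nth
  proof (intro allI impI)
    fix i j assume "i < length (cols C)" "j < length (cols C)" "i \<noteq> j"
    then show "cols C ! i \<noteq> cols C ! j"
      using scalar[of i j] scalar[of i i] C(1) by auto
  qed
  have "lin_indpt (set (cols C))"
  proof
    assume "lin_dep (set (cols C))"
    from lin_depE[OF C(1) this dist] obtain v where v: "v \<in> carrier_vec c" "v \<noteq> 0\<^sub>v c" "C *\<^sub>v v = 0\<^sub>v m"
      by blast
    have "v = (C\<^sup>T * C) *\<^sub>v v" using v CC by simp
    also have "\<dots> = C\<^sup>T *\<^sub>v (C *\<^sub>v v)" using C(1) v by (simp add: assoc_mult_mat_vec[of _ c m _ c])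
    also have "\<dots> = 0\<^sub>v c" using C(1) by (intro eq_vecI) (auto simp: v(3))
    finally show False using v by simp
  qed
  from lin_indpt_full_rank[OF C(1) dist this] show ?thesis using C(1) by (simp add: mat_rank_def)
qed

text \<open>Ties the definition by roots of the characteristic polynomial to any decreasingly
  ordered eigendecomposition: \<open>A * A\<^sup>T\<close> is similar to the diagonal matrix of
  \<open>d\<close>, whose characteristic polynomial has exactly these roots with
  multiplicity.\<close>

lemma singular_values_eq:
  fixes A Q :: "real mat"
  assumes A: "dim_row A = m" and Q: "Q \<in> carrier_mat m m" "Q\<^sup>T * Q = 1\<^sub>m m"
    and eq: "A * A\<^sup>T * Q = Q * mat_diag m d"
    and mono: "\<And>i j. i \<le> j \<Longrightarrow> j < m \<Longrightarrow> d j \<le> d i"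
  shows "singular_values A = map (\<lambda>j. sqrt (d j)) [0..<m]"
proof -
  have QQ: "Q * Q\<^sup>T = 1\<^sub>m m" using mat_mult_left_right_inverse[of "Q\<^sup>T" m Q] Q by simp
  have M: "A * A\<^sup>T \<in> carrier_mat m m" using A by auto
  have "A * A\<^sup>T = A * A\<^sup>T * (Q * Q\<^sup>T)" using QQ right_mult_one_mat[OF M] by simp
  also have "\<dots> = (A * A\<^sup>T * Q) * Q\<^sup>T"
    using Q(1) M assoc_mult_mat[of "A * A\<^sup>T" m m Q m "Q\<^sup>T" m] by simp
  also have "\<dots> = Q * mat_diag m d * Q\<^sup>T" unfolding eq ..
  finally have "similar_mat (A * A\<^sup>T) (mat_diag m d)"
    unfolding similar_mat_def using Q QQ M
    by (intro exI[of _ Q] exI[of _ "Q\<^sup>T"] similar_mat_witI[of _ _ m]) auto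
  then have "char_poly (A * A\<^sup>T) = char_poly (mat_diag m d)" by (rule char_poly_similar)
  also have "\<dots> = (\<Prod>a\<leftarrow>diag_mat (mat_diag m d). [:- a, 1:])"
    by (rule char_poly_upper_triangular[of _ m]) (auto simp: mat_diag_def)
  also have "diag_mat (mat_diag m d) = map d [0..<m]"
    by (auto simp: diag_mat_def mat_diag_def intro!: nth_equalityI)
  finally have "char_poly (A * A\<^sup>T) = (\<Prod>a\<leftarrow>map d [0..<m]. [:- a, 1:])" .
  moreover have "proots (\<Prod>a\<leftarrow>xs. [:- a, 1:]) = mset xs" for xs :: "real list"
  proof (induction xs)
    case (Cons a xs)
    have "(\<Prod>a\<leftarrow>xs. [:- a, 1:]) \<noteq> 0" by (auto simp: prod_list_zero_iff)
    then have "proots ([:- a, 1:] * (\<Prod>a\<leftarrow>xs. [:- a, 1:])) = proots [:- a, 1:] + mset xs"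
      by (subst proots_mult) (auto simp: Cons.IH)
    then show ?case by simp
  qed simp
  ultimately have "proots (char_poly (A * A\<^sup>T)) = mset (map d [0..<m])" by (rule ssubst)
  then have "sorted_list_of_multiset (proots (char_poly (A * A\<^sup>T))) = sort (map d [0..<m])"
    by (simp only: sorted_list_of_multiset_mset)
  also have "\<dots> = rev (map d [0..<m])"
    by (rule properties_for_sort) (auto simp: sorted_iff_nth_mono rev_nth intro!: mono)
  finally show ?thesis by (simp add: singular_values_def)
qed

text \<open>The columns of \<open>C\<close> are eigenvectors of \<open>A * A\<^sup>T\<close> for the
  positive eigenvalues. \<open>B\<close> stands for the singular values times the transposed right
  singular vectors, left unnormalized, so its rows are orthogonal with squared lengths
  \<open>d j\<close>. Positivity is placed under the quantifier because at rank 0 the value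
  \<open>sing_val A 0\<close> is 0.\<close>

theorem thin_svd:
  fixes A :: "real mat"
  assumes A: "A \<in> carrier_mat m n"
  obtains C B d where "C \<in> carrier_mat m (mat_rank A)" "B \<in> carrier_mat (mat_rank A) n"
    "orthonormal_cols C" "A = C * B" "B * B\<^sup>T = mat_diag (mat_rank A) d"
    "\<forall>j<mat_rank A. 0 < sing_val A (mat_rank A) \<and> (sing_val A (mat_rank A))\<^sup>2 \<le> d j"
proof -
  have M: "A * A\<^sup>T \<in> carrier_mat m m" "(A * A\<^sup>T)\<^sup>T = A * A\<^sup>T"
    using A by (auto simp: transpose_mult_dim)
  obtain Q d where Q: "Q \<in> carrier_mat m m" "Q\<^sup>T * Q = 1\<^sub>m m" "A * A\<^sup>T * Q = Q * mat_diag m d"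
    and mono: "\<And>i j. i \<le> j \<Longrightarrow> j < m \<Longrightarrow> d j \<le> d i"
    using sorted_real_spectral_theorem[OF M] by blast
  have sv: "singular_values A = map (\<lambda>j. sqrt (d j)) [0..<m]"
    using singular_values_eq[OF _ Q mono] A by simp
  have QQ: "Q * Q\<^sup>T = 1\<^sub>m m" using mat_mult_left_right_inverse[of "Q\<^sup>T" m Q] Q by simp
  define B0 where "B0 = Q\<^sup>T * A"
  have B0: "B0 \<in> carrier_mat m n" using Q A by (auto simp: B0_def)
  have "B0 * B0\<^sup>T = Q\<^sup>T * (A * A\<^sup>T * Q)"
    using Q(1) A by (simp add: B0_def transpose_mult_dim assoc_mult_mat_dim)
  also have "\<dots> = (Q\<^sup>T * Q) * mat_diag m d"
    unfolding Q(3) using Q(1) by (simp add: assoc_mult_mat_dim mat_diag_def)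
  finally have BB0: "B0 * B0\<^sup>T = mat_diag m d" by (simp add: Q(2) mat_diag_def)
  have BB0': "(\<Sum>k<n. B0 $$ (i, k) * B0 $$ (j, k)) = (if i = j then d j else 0)"
    if "i < m" "j < m" for i j
    using arg_cong[OF BB0, of "\<lambda>M. M $$ (i, j)"] that B0
    by (simp add: mult_mat_index mat_diag_def del: index_mult_mat(1))
  have d0: "0 \<le> d j" if "j < m" for j
    using BB0'[OF that that] sum_nonneg[of "{..<n}" "\<lambda>k. B0 $$ (j, k) * B0 $$ (j, k)"] by simp
  have Bzero: "B0 $$ (j, k) = 0" if "j < m" "d j = 0" "k < n" for j k
    using BB0'[OF that(1) that(1)] that(2,3)
      sum_nonneg_eq_0_iff[of "{..<n}" "\<lambda>k. B0 $$ (j, k) * B0 $$ (j, k)"] by simp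
  \<comment> \<open>\<open>c\<close> counts the positive eigenvalues: they are nonnegative and
    decreasing, so all vanish from the first zero on. The corresponding rows of \<open>B0\<close>
    vanish as well, and truncating at \<open>c\<close> keeps the product.\<close>
  define c where "c = (LEAST j. j = m \<or> d j = 0)"
  have cm: "c \<le> m" unfolding c_def by (rule Least_le) simp
  have dpos: "0 < d j" if "j < c" for j
    using not_less_Least[of j "\<lambda>j. j = m \<or> d j = 0"] that d0[of j] cm by (auto simp: c_def less_le)
  have "c = m \<or> d c = 0" unfolding c_def by (rule LeastI[of _ m]) simp
  then have dzero: "d j = 0" if "c \<le> j" "j < m" for j
    using mono[of c j] d0[of j] that by auto
  define C where "C = mat m c (\<lambda>(i, j). Q $$ (i, j))"
  define B where "B = mat c n (\<lambda>(i, j). B0 $$ (i, j))"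
  have C: "C \<in> carrier_mat m c" and B: "B \<in> carrier_mat c n" by (auto simp: C_def B_def)
  have "A = Q * B0" using Q(1) A QQ
    by (simp add: B0_def assoc_mult_mat_dim[symmetric])
  moreover have "Q * B0 = C * B"
  proof (rule eq_matI)
    fix i j assume "i < dim_row (C * B)" "j < dim_col (C * B)"
    then have ij: "i < m" "j < n" using C B by auto
    have "(Q * B0) $$ (i, j) = (\<Sum>k<m. Q $$ (i, k) * B0 $$ (k, j))"
      using ij Q(1) B0 by (subst mult_mat_index) auto
    also have "\<dots> = (\<Sum>k<c. Q $$ (i, k) * B0 $$ (k, j))"
      using cm ij Bzero dzero by (intro sum.mono_neutral_right) auto
    also have "\<dots> = (C * B) $$ (i, j)"
      using ij by (subst mult_mat_index) (auto simp: C_def B_def)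
    finally show "(Q * B0) $$ (i, j) = (C * B) $$ (i, j)" .
  qed (use C B Q B0 in auto)
  ultimately have ACB: "A = C * B" by simp
  have CC: "orthonormal_cols C"
    unfolding orthonormal_cols_def
  proof (rule eq_matI)
    fix i j assume "i < dim_row (1\<^sub>m (dim_col C) :: real mat)" "j < dim_col (1\<^sub>m (dim_col C) :: real mat)"
    then have ij: "i < c" "j < c" using C by auto
    have "(C\<^sup>T * C) $$ (i, j) = (\<Sum>k<m. Q $$ (k, i) * Q $$ (k, j))"
      using ij by (subst mult_mat_index) (auto simp: C_def)
    also have "\<dots> = (Q\<^sup>T * Q) $$ (i, j)"
      using ij cm Q(1) by (subst mult_mat_index) auto
    finally show "(C\<^sup>T * C) $$ (i, j) = 1\<^sub>m (dim_col C) $$ (i, j)"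
      using ij cm Q(2) C by simp
  qed (use C in auto)
  have BB: "B * B\<^sup>T = mat_diag c d"
  proof (rule eq_matI)
    fix i j assume "i < dim_row (mat_diag c d)" "j < dim_col (mat_diag c d)"
    then have ij: "i < c" "j < c" by (auto simp: mat_diag_def)
    have "(B * B\<^sup>T) $$ (i, j) = (\<Sum>k<n. B0 $$ (i, k) * B0 $$ (j, k))"
      using ij by (subst mult_mat_index) (auto simp: B_def)
    then show "(B * B\<^sup>T) $$ (i, j) = mat_diag c d $$ (i, j)"
      using BB0'[of i j] ij cm by (simp add: mat_diag_def)
  qed (use B in \<open>auto simp: mat_diag_def\<close>)
  \<comment> \<open>\<open>E\<close> is a right inverse of \<open>B\<close>, so that
    \<open>C = A * E\<close>. Together with \<open>A = C * B\<close> this identifies the rank of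
    \<open>A\<close> with the number \<open>c\<close> of columns of \<open>C\<close>.\<close>
  define E where "E = B\<^sup>T * mat_diag c (\<lambda>j. 1 / d j)"
  have E: "E \<in> carrier_mat n c" using B by (auto simp: E_def mat_diag_def)
  have "A * E = C * ((B * B\<^sup>T) * mat_diag c (\<lambda>j. 1 / d j))"
    using C B by (simp add: ACB E_def assoc_mult_mat_dim mat_diag_def)
  also have "(B * B\<^sup>T) * mat_diag c (\<lambda>j. 1 / d j) = 1\<^sub>m c"
    unfolding BB mat_diag_diag using dpos by (intro eq_matI) (auto simp: mat_diag_def less_imp_neq[symmetric])
  finally have "C = A * E" using C by simp
  then have "mat_rank A = mat_rank C" by (rule mat_rank_cong[OF A C B E ACB])
  then have rank: "mat_rank A = c" using mat_rank_orthonormal_cols[OF C CC] by simp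
  \<comment> \<open>The eigenvalue list has length \<open>m\<close>, but \<open>sing_val\<close>
    returns its default 0 beyond \<open>min m n\<close>. The bound \<open>c \<le> n\<close> ensures
    that position \<open>c\<close>, counted from 1, really reads
    \<open>sqrt (d (c - 1))\<close>.\<close>
  have "vec_space.rank m A \<le> n" by (rule vec_space.rank_le_nc[OF A])
  then have cn: "c \<le> n" using rank A by (simp add: mat_rank_def)
  show thesis
  proof (rule that[of C B d, unfolded rank])
    show "\<forall>j<c. 0 < sing_val A c \<and> (sing_val A c)\<^sup>2 \<le> d j"
    proof (intro allI impI)
      fix j assume j: "j < c"
      have "[0..<m] ! (c - 1) = c - 1" using j cm by (subst nth_upt) auto
      then have "sing_val A c = sqrt (d (c - 1))"
        using j cm cn A by (simp add: sing_val_def sv)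
      then show "0 < sing_val A c \<and> (sing_val A c)\<^sup>2 \<le> d j"
        using j cm dpos[of "c - 1"] mono[of j "c - 1"] by simp
    qed
  qed (use C B CC ACB BB in auto)
qed

lemma sing_val_rank_pos:
  assumes "A \<in> carrier_mat m n" "A \<noteq> 0\<^sub>m m n"
  shows "0 < sing_val A (mat_rank A)"
proof -
  obtain C B d where svd: "C \<in> carrier_mat m (mat_rank A)" "B \<in> carrier_mat (mat_rank A) n"
    "orthonormal_cols C" "A = C * B" "B * B\<^sup>T = mat_diag (mat_rank A) d"
    "\<forall>j<mat_rank A. 0 < sing_val A (mat_rank A) \<and> (sing_val A (mat_rank A))\<^sup>2 \<le> d j"
    using thin_svd[OF assms(1)] .
  have "mat_rank A \<noteq> 0"
  proof
    assume "mat_rank A = 0"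
    with svd(1,2) have "C \<in> carrier_mat m 0" "B \<in> carrier_mat 0 n" by simp_all
    then have "C * B = 0\<^sub>m m n" by (intro eq_matI) (auto simp: scalar_prod_def)
    then show False using svd(4) assms(2) by simp
  qed
  then show ?thesis using svd(6) by simp
qed

text \<open>With the thin singular value decomposition \<open>A = C B\<close> the product \<open>P A R\<close> splits as
  \<open>(P C) (B R)\<close>; multiplying \<open>P C\<close> by \<open>B\<close> stretches it by at least the smallest nonzero singular
  value, and multiplying \<open>B R\<close> by \<open>C\<close> is an isometry.\<close>

theorem frob_norm_two_sided:
  fixes A :: "real mat"
  assumes A: "A \<in> carrier_mat m n" "A \<noteq> 0\<^sub>m m n" and P: "dim_col P = m" and R: "dim_row R = n"
  shows "frob_norm (P * A * R) \<le> frob_norm (P * A) * frob_norm (A * R) / sing_val A (mat_rank A)"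
proof -
  let ?s = "sing_val A (mat_rank A)"
  let ?c = "mat_rank A"
  obtain C B d where C: "C \<in> carrier_mat m ?c" and B: "B \<in> carrier_mat ?c n"
    and svd: "orthonormal_cols C" "A = C * B" "B * B\<^sup>T = mat_diag ?c d"
    "\<forall>j<?c. 0 < ?s \<and> ?s\<^sup>2 \<le> d j"
    using thin_svd[OF A(1)] .
  have s: "0 < ?s" by (rule sing_val_rank_pos[OF A])
  define Y where "Y = P * C"
  have Y: "Y \<in> carrier_mat (dim_row P) ?c" using C by (auto simp: Y_def)
  have PA: "P * A = Y * B" and AR: "A * R = C * (B * R)"
    using P R C B by (simp_all add: svd(2) Y_def assoc_mult_mat_dim)
  have PAR: "P * A * R = Y * (B * R)"
    using R Y B unfolding PA by (simp add: assoc_mult_mat_dim)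
  have "(Y * B) * (Y * B)\<^sup>T = Y * (B * B\<^sup>T) * Y\<^sup>T"
    using Y B by (simp add: transpose_mult_dim[of Y B] assoc_mult_mat_dim)
  then have YB: "(Y * B) * (Y * B)\<^sup>T = (Y * mat_diag ?c d) * Y\<^sup>T" unfolding svd(3) .
  have "?s\<^sup>2 * (frob_norm Y)\<^sup>2 = (\<Sum>i<dim_row P. \<Sum>j<?c. ?s\<^sup>2 * (Y $$ (i, j))\<^sup>2)"
    unfolding frob_norm_def using Y
    by (subst real_sqrt_pow2) (auto simp: sum_distrib_left intro!: sum_nonneg)
  \<comment> \<open>Every \<open>d j\<close> below the rank is at least the square of the smallest
    nonzero singular value. The weighted sum is the trace of the Gram matrix of
    \<open>P * A\<close>.\<close>
  also have "\<dots> \<le> (\<Sum>i<dim_row P. \<Sum>j<?c. d j * (Y $$ (i, j))\<^sup>2)"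
    using svd(4) by (intro sum_mono mult_right_mono) auto
  also have "\<dots> = (\<Sum>i<dim_row P. ((Y * mat_diag ?c d) * Y\<^sup>T) $$ (i, i))"
    unfolding mat_diag_mult_right[OF Y] using Y
    by (intro sum.cong refl) (subst mult_mat_index, auto simp: power2_eq_square mult_ac)
  also have "\<dots> = (frob_norm (P * A))\<^sup>2"
    unfolding frob_norm_sq PA YB index_mult_mat(2) using Y by (simp only: carrier_matD)
  finally have "(?s * frob_norm Y)\<^sup>2 \<le> (frob_norm (P * A))\<^sup>2" by (simp add: power_mult_distrib)
  then have "?s * frob_norm Y \<le> frob_norm (P * A)"
    using power2_le_imp_le frob_norm_nonneg by blast
  then have "frob_norm Y \<le> frob_norm (P * A) / ?s" using s by (simp add: field_simps)
  moreover have "frob_norm (B * R) = frob_norm (A * R)"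
    unfolding AR using frob_norm_orthonormal_mult[OF svd(1), of "B * R"] C B by simp
  moreover have "frob_norm (P * A * R) \<le> frob_norm Y * frob_norm (B * R)"
    unfolding PAR by (rule frob_norm_mult) (use Y B in simp)
  ultimately have "frob_norm (P * A * R) \<le> frob_norm (P * A) / ?s * frob_norm (A * R)"
    using mult_right_mono[OF _ frob_norm_nonneg] by (smt (verit))
  then show ?thesis by simp
qed


section \<open>Kronecker products and multi-indices\<close>

lemma sum_div_mod:
  fixes f :: "nat \<Rightarrow> nat \<Rightarrow> real"
  shows "(\<Sum>k<m * n. f (k div n) (k mod n)) = (\<Sum>i<m. \<Sum>j<n. f i j)"
proof -
  have "i * n + j < m * n" if "i < m" "j < n" for i j :: nat
  proof -
    have "i * n + j < Suc i * n" using that by simp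
    also have "\<dots> \<le> m * n" using that by (intro mult_le_mono1) simp
    finally show ?thesis .
  qed
  then have "(\<Sum>k<m * n. f (k div n) (k mod n)) = (\<Sum>(i, j)\<in>{..<m} \<times> {..<n}. f i j)"
    by (intro sum.reindex_bij_witness[of _ "\<lambda>(i, j). i * n + j" "\<lambda>k. (k div n, k mod n)"])
      (auto simp: less_mult_imp_div_less intro!: mod_less_divisor gr0I)
  then show ?thesis by (simp add: sum.cartesian_product)
qed

lemma kron_dims [simp]:
  "dim_row (kron A B) = dim_row A * dim_row B" "dim_col (kron A B) = dim_col A * dim_col B"
  by (auto simp: kron_def)

lemma kron_index:
  assumes "i < dim_row A * dim_row B" "j < dim_col A * dim_col B"
  shows "kron A B $$ (i, j)
    = A $$ (i div dim_row B, j div dim_col B) * B $$ (i mod dim_row B, j mod dim_col B)"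
  using assms by (simp add: kron_def)

lemma less_mult_imp_mod_less: "i < m * n \<Longrightarrow> i mod n < (n::nat)"
  by (cases "n = 0") auto

text \<open>The mixed-product rule: splitting the summation index into quotient and remainder turns
  the sum into a product of two sums.\<close>

lemma kron_mult:
  assumes "dim_col A = dim_row C" "dim_col B = dim_row D"
  shows "kron A B * kron C D = kron (A * C) (B * D)"
proof (rule eq_matI)
  fix i j assume "i < dim_row (kron (A * C) (B * D))" "j < dim_col (kron (A * C) (B * D))"
  then have ij: "i < dim_row A * dim_row B" "j < dim_col C * dim_col D" by auto
  let ?a = "\<lambda>k. A $$ (i div dim_row B, k) * C $$ (k, j div dim_col D)"
  let ?b = "\<lambda>k. B $$ (i mod dim_row B, k) * D $$ (k, j mod dim_col D)"
  have "(kron A B * kron C D) $$ (i, j) = (\<Sum>k<dim_row C * dim_row D. ?a (k div dim_row D) * ?b (k mod dim_row D))"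
    using ij assms by (subst mult_mat_index) (auto simp: kron_index intro!: sum.cong)
  also have "\<dots> = (\<Sum>k<dim_row C. ?a k) * (\<Sum>l<dim_row D. ?b l)"
    by (subst sum_div_mod[of "\<lambda>k l. ?a k * ?b l"]) (simp add: sum_product)
  also have "\<dots> = kron (A * C) (B * D) $$ (i, j)"
    using ij assms
    by (simp add: kron_index mult_mat_index less_mult_imp_div_less less_mult_imp_mod_less
        del: index_mult_mat(1))
  finally show "(kron A B * kron C D) $$ (i, j) = kron (A * C) (B * D) $$ (i, j)" .
qed auto

lemma kron_transpose: "(kron A B)\<^sup>T = kron A\<^sup>T B\<^sup>T"
  by (rule eq_matI) (auto simp: kron_index less_mult_imp_div_less less_mult_imp_mod_less)

lemma kron_one: "kron (1\<^sub>m m) (1\<^sub>m n) = 1\<^sub>m (m * n)"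
proof (rule eq_matI)
  fix i j assume "i < dim_row (1\<^sub>m (m * n) :: real mat)" "j < dim_col (1\<^sub>m (m * n) :: real mat)"
  then have ij: "i < m * n" "j < m * n" by auto
  have "i = j \<longleftrightarrow> i div n = j div n \<and> i mod n = j mod n"
    by (metis div_mult_mod_eq)
  then show "kron (1\<^sub>m m) (1\<^sub>m n) $$ (i, j) = 1\<^sub>m (m * n) $$ (i, j)"
    using ij by (auto simp: kron_index less_mult_imp_div_less less_mult_imp_mod_less)
qed auto

lemma kron_list_simps [simp]:
  "kron_list [] = 1\<^sub>m 1" "kron_list (A # As) = kron A (kron_list As)"
  by (simp_all add: kron_list_def)

lemma kron_list_dims [simp]:
  "dim_row (kron_list As) = prod_list (map dim_row As)"
  "dim_col (kron_list As) = prod_list (map dim_col As)"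
  by (induction As) auto

text \<open>Allows orthonormality and idempotence of long Kronecker products to be checked factor by
  factor.\<close>

lemma kron_list_mult:
  assumes "\<And>x. x \<in> set xs \<Longrightarrow> dim_col (f x) = dim_row (g x)"
  shows "kron_list (map f xs) * kron_list (map g xs) = kron_list (map (\<lambda>x. f x * g x) xs)"
  using assms
proof (induction xs)
  case (Cons x xs)
  have "map (dim_col \<circ> f) xs = map (dim_row \<circ> g) xs" using Cons.prems by simp
  then have "prod_list (map (dim_col \<circ> f) xs) = prod_list (map (dim_row \<circ> g) xs)" by (rule arg_cong)
  then show ?case using Cons by (simp add: kron_mult)
qed simp

lemma kron_list_transpose: "(kron_list (map f xs))\<^sup>T = kron_list (map (\<lambda>x. (f x)\<^sup>T) xs)"
  by (induction xs) (auto simp: kron_transpose)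

lemma kron_list_one: "kron_list (map (\<lambda>x. 1\<^sub>m (n x)) xs) = 1\<^sub>m (prod_list (map n xs))"
  by (induction xs) (auto simp: kron_one)

text \<open>The coefficient, from input multi-index \<open>j\<close> to output multi-index
  \<open>i\<close>, of the multilinear map with factors \<open>As\<close>. It mediates between mode
  products, which act on multi-indices, and Kronecker matrices, which act on linear indices.\<close>

definition kron_entry :: "real mat list \<Rightarrow> nat list \<Rightarrow> nat list \<Rightarrow> real" where
  "kron_entry As i j = prod_list (map (\<lambda>(A, ij). A $$ ij) (zip As (zip i j)))"

lemma kron_entry_simps [simp]:
  "kron_entry [] i j = 1"
  "kron_entry (A # As) (a # i) (b # j) = A $$ (a, b) * kron_entry As i j"
  by (simp_all add: kron_entry_def)

lemma kron_entry_append: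
  "length i = length As \<Longrightarrow> length j = length As \<Longrightarrow>
    kron_entry (As @ Bs) (i @ i') (j @ j') = kron_entry As i j * kron_entry Bs i' j'"
  by (simp add: kron_entry_def)

section \<open>Multi-indices and their linearization\<close>

lemma indices_length: "i \<in> indices p \<Longrightarrow> length i = length p"
  by (auto simp: indices_def dest: list_all2_lengthD)

lemma indices_Nil [simp]: "indices [] = {[]}"
  by (auto simp: indices_def)

lemma Cons_mem_indices [simp]: "a # i \<in> indices (n # p) \<longleftrightarrow> a < n \<and> i \<in> indices p"
  by (auto simp: indices_def)

lemma append_mem_indices:
  "length i = length p \<Longrightarrow> i @ i' \<in> indices (p @ p') \<longleftrightarrow> i \<in> indices p \<and> i' \<in> indices p'"
  by (auto simp: indices_def list_all2_append)

lemma indices_nth: "i \<in> indices p \<Longrightarrow> k < length p \<Longrightarrow> i ! k < p ! k"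
  by (auto simp: indices_def list_all2_conv_all_nth)

lemma indices_ConsE:
  assumes "i \<in> indices (n # p)"
  obtains a i' where "i = a # i'" "a < n" "i' \<in> indices p"
  using assms by (cases i) (auto simp: indices_def)

lemma flatten_less: "i \<in> indices p \<Longrightarrow> flatten p i < prod_list p"
proof (induction p arbitrary: i)
  case (Cons n p)
  then obtain a i' where i: "i = a # i'" "a < n" "i' \<in> indices p" by (blast elim: indices_ConsE)
  have "a + n * flatten p i' < n * Suc (flatten p i')" using i(2) by simp
  also have "\<dots> \<le> n * prod_list p" using Cons.IH[OF i(3)] by (intro mult_le_mono2) simp
  finally show ?case using i by simp
qed simp

lemma unflatten_mem: "c < prod_list p \<Longrightarrow> unflatten p c \<in> indices p"
proof (induction p arbitrary: c)
  case (Cons n p)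
  then have "c div n < prod_list p" by (simp add: less_mult_imp_div_less mult.commute)
  moreover have "c mod n < n" using Cons.prems less_mult_imp_mod_less[of c "prod_list p" n]
    by (simp add: mult.commute)
  ultimately show ?case using Cons.IH by simp
qed simp

lemma unflatten_flatten: "i \<in> indices p \<Longrightarrow> unflatten p (flatten p i) = i"
proof (induction p arbitrary: i)
  case (Cons n p)
  then obtain a i' where "i = a # i'" "a < n" "i' \<in> indices p" by (blast elim: indices_ConsE)
  then show ?case using Cons.IH by simp
qed simp

lemma flatten_unflatten: "c < prod_list p \<Longrightarrow> flatten p (unflatten p c) = c"
proof (induction p arbitrary: c)
  case (Cons n p)
  then have "c div n < prod_list p" by (simp add: less_mult_imp_div_less mult.commute)
  then show ?case using Cons.IH by simp
qed simp

lemma sum_indices_flat: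
  "(\<Sum>j\<in>indices p. f j) = (\<Sum>c<prod_list p. f (unflatten p c))"
  by (rule sum.reindex_bij_witness[of _ "unflatten p" "flatten p"])
    (auto simp: flatten_less unflatten_mem unflatten_flatten flatten_unflatten)

lemma flatten_append:
  "length i = length p \<Longrightarrow> flatten (p @ q) (i @ j) = flatten p i + prod_list p * flatten q j"
  by (induction p arbitrary: i) (auto simp: length_Suc_conv algebra_simps)

text \<open>The list is reversed because \<open>flatten\<close> lets the earliest index vary
  fastest, whereas in \<open>kron\<close> the index of the last factor does. Induction from the end
  makes the newest matrix the outermost Kronecker factor, whose index is the quotient of the linear
  index.\<close>

lemma kron_list_rev_entry:
  assumes "i \<in> indices (map dim_row As)" "j \<in> indices (map dim_col As)"
  shows "kron_list (rev As) $$ (flatten (map dim_row As) i, flatten (map dim_col As) j)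
    = kron_entry As i j"
  using assms
proof (induction As arbitrary: i j rule: rev_induct)
  case (snoc A As)
  have split: "\<exists>i' a. i = i' @ [a] \<and> i' \<in> indices p \<and> a < n" if "i \<in> indices (p @ [n])" for i p n
  proof -
    have "length i = Suc (length p)" using indices_length[OF that] by simp
    then obtain i' a where i: "i = i' @ [a]" "length i' = length p"
      by (metis append_butlast_last_id diff_Suc_1 length_0_conv length_butlast nat.distinct(1))
    then show ?thesis using that by (auto simp: append_mem_indices)
  qed
  obtain i' a where i: "i = i' @ [a]" "i' \<in> indices (map dim_row As)" "a < dim_row A"
    using split[of i "map dim_row As" "dim_row A"] snoc.prems by auto
  obtain j' b where j: "j = j' @ [b]" "j' \<in> indices (map dim_col As)" "b < dim_col A"
    using split[of j "map dim_col As" "dim_col A"] snoc.prems by auto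
  have len: "length i' = length As" "length j' = length As"
    using i(2) j(2) by (auto dest: indices_length)
  have less: "flatten (map dim_row As) i' < prod_list (map dim_row As)"
      "flatten (map dim_col As) j' < prod_list (map dim_col As)"
    using i(2) j(2) by (simp_all add: flatten_less)
  have bound: "x + P * a < n * P" if "x < P" "a < n" for x P a n :: nat
  proof -
    have "x + P * a < P * Suc a" using that by simp
    also have "\<dots> \<le> P * n" using that by (intro mult_le_mono2) simp
    finally show ?thesis by (simp add: mult.commute)
  qed
  have div: "(x + P * a) div P = a" if "x < P" for x P a :: nat
    using that by (cases "P = 0") auto
  show ?case
    using less len i j
    by (simp add: kron_index flatten_append kron_entry_append snoc.IH[OF i(2) j(2)]
        rev_map[symmetric] bound div)
qed simp

lemma finite_indices [simp]: "finite (indices p)"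
proof (induction p)
  case (Cons n p)
  have "indices (n # p) \<subseteq> (\<lambda>(a, i). a # i) ` ({..<n} \<times> indices p)"
    by (auto elim!: indices_ConsE)
  then show ?case using Cons finite_subset by blast
qed simp

lemma length_del_mode: "k < length p \<Longrightarrow> length (del_mode k p) = length p - 1"
  by (simp add: del_mode_def)

lemma del_mode_ins_mode:
  "k \<le> length j \<Longrightarrow> del_mode k (ins_mode k a j) = j" "k \<le> length j \<Longrightarrow> ins_mode k a j ! k = a"
  by (simp_all add: del_mode_def ins_mode_def nth_append)

lemma ins_mode_del_mode: "k < length i \<Longrightarrow> ins_mode k (i ! k) (del_mode k i) = i"
  by (simp add: del_mode_def ins_mode_def id_take_nth_drop[symmetric])

lemma map_del_mode: "map f (del_mode k xs) = del_mode k (map f xs)"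
  by (simp add: del_mode_def take_map drop_map)

lemma take_mem_indices: "i \<in> indices p \<Longrightarrow> take k i \<in> indices (take k p)"
  by (simp add: indices_def list_all2_takeI)

lemma drop_mem_indices: "i \<in> indices p \<Longrightarrow> drop k i \<in> indices (drop k p)"
  by (simp add: indices_def list_all2_dropI)

lemma del_mode_mem: "i \<in> indices p \<Longrightarrow> del_mode k i \<in> indices (del_mode k p)"
  using append_mem_indices[of "take k i" "take k p" "drop (Suc k) i" "drop (Suc k) p"]
  by (simp add: del_mode_def take_mem_indices drop_mem_indices indices_length)

lemma ins_mode_mem:
  assumes "k < length p" "a < p ! k" "j \<in> indices (del_mode k p)"
  shows "ins_mode k a j \<in> indices p"
proof -
  have "length j = length p - 1" using indices_length[OF assms(3)] assms(1) by (simp add: length_del_mode)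
  then have "take k j \<in> indices (take k p)" "drop k j \<in> indices (drop (Suc k) p)"
    using take_mem_indices[OF assms(3), of k] drop_mem_indices[OF assms(3), of k] assms(1)
    by (simp_all add: del_mode_def)
  then have "take k j @ a # drop k j \<in> indices (take k p @ p ! k # drop (Suc k) p)"
    using assms(2) by (subst append_mem_indices) (auto dest: indices_length)
  then show ?thesis using assms(1) by (simp add: ins_mode_def id_take_nth_drop[symmetric])
qed

lemma sum_indices_mode:
  fixes f :: "nat list \<Rightarrow> real"
  assumes "k < length p"
  shows "(\<Sum>i\<in>indices p. f i) = (\<Sum>a<p ! k. \<Sum>j\<in>indices (del_mode k p). f (ins_mode k a j))"
proof -
  have len: "k \<le> length j" if "j \<in> indices (del_mode k p)" for j
    using indices_length[OF that] assms by (simp add: length_del_mode)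
  have "(\<Sum>i\<in>indices p. f i) = (\<Sum>(a, j)\<in>{..<p ! k} \<times> indices (del_mode k p). f (ins_mode k a j))"
    by (rule sum.reindex_bij_witness[of _ "\<lambda>(a, j). ins_mode k a j" "\<lambda>i. (i ! k, del_mode k i)"])
      (use assms len in \<open>auto simp: ins_mode_del_mode del_mode_ins_mode ins_mode_mem del_mode_mem
        indices_nth indices_length\<close>)
  then show ?thesis by (simp add: sum.cartesian_product)
qed


section \<open>Mode products and matricizations\<close>

lemma list_update_mem_indices:
  assumes "i \<in> indices p" "k < length p" "a < p' ! k" "length p' = length p"
    and "\<And>l. l < length p \<Longrightarrow> l \<noteq> k \<Longrightarrow> p' ! l = p ! l"
  shows "i[k := a] \<in> indices p'"
  using assms by (auto simp: indices_def list_all2_conv_all_nth nth_list_update)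

text \<open>The closed form is stated for any number \<open>n\<close> of products so that induction
  applies: the first \<open>n\<close> modes already have the new sizes, the others are untouched and
  enter only through \<open>drop n i\<close>.\<close>

lemma mode_prods_upto:
  assumes X: "X \<in> tensors p" and len: "length q = length p"
    and A: "\<And>l. l < length p \<Longrightarrow> A l \<in> carrier_mat (q ! l) (p ! l)"
    and n: "n \<le> length p"
  shows "mode_prods p X A n i = (if i \<in> indices (take n q @ drop n p)
    then \<Sum>j\<in>indices (take n p). kron_entry (map A [0..<n]) (take n i) j * X (j @ drop n i) else 0)"
  using n
proof (induction n arbitrary: i)
  case 0
  then show ?case using X by (auto simp: tensors_def)
next
  case (Suc n)
  let ?s = "take n q @ drop n p"
  have n: "n < length p" using Suc.prems by simp
  have rows: "map (\<lambda>j. dim_row (A j)) [0..<n] = take n q"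
    using n len carrier_matD(1)[OF A] by (intro nth_equalityI) auto
  have dA: "dim_row (A n) = q ! n" using A[OF n] by simp
  have snth: "?s ! n = p ! n" "length ?s = length p" using n len by (auto simp: nth_append)
  have supd: "?s[n := q ! n] = take (Suc n) q @ drop (Suc n) p"
  proof -
    have "?s = take n q @ p ! n # drop (Suc n) p" using n by (simp add: Cons_nth_drop_Suc)
    then show ?thesis using n len by (simp add: list_update_append take_Suc_conv_app_nth)
  qed
  show ?case
  proof (cases "i \<in> indices (take (Suc n) q @ drop (Suc n) p)")
    case False
    then show ?thesis by (simp add: mode_prod_def rows dA supd)
  next
    case True
    have li: "length i = length p" using indices_length[OF True] n len by simp
    have mem: "i[n := a] \<in> indices ?s" if "a < p ! n" for a
      by (rule list_update_mem_indices[OF True[folded supd]]) (use that snth n in auto)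
    have "mode_prods p X A (Suc n) i = (\<Sum>a<p ! n. A n $$ (i ! n, a) * mode_prods p X A n (i[n := a]))"
      using True by (simp add: mode_prod_def rows dA supd snth)
    also have "\<dots> = (\<Sum>a<p ! n. \<Sum>j\<in>indices (take n p). A n $$ (i ! n, a)
        * (kron_entry (map A [0..<n]) (take n i) j * X (j @ a # drop (Suc n) i)))"
    proof (rule sum.cong[OF refl])
      fix a assume a: "a \<in> {..<p ! n}"
      have "drop n (i[n := a]) = a # drop (Suc n) i"
        using n li by (simp add: upd_conv_take_nth_drop)
      then show "A n $$ (i ! n, a) * mode_prods p X A n (i[n := a])
        = (\<Sum>j\<in>indices (take n p). A n $$ (i ! n, a)
          * (kron_entry (map A [0..<n]) (take n i) j * X (j @ a # drop (Suc n) i)))"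
        using a n by (simp add: Suc.IH mem sum_distrib_left)
    qed
    also have "\<dots> = (\<Sum>a<p ! n. \<Sum>j\<in>indices (take n p). kron_entry (map A [0..<Suc n]) (take (Suc n) i) (j @ [a])
        * X ((j @ [a]) @ drop (Suc n) i))"
    proof (intro sum.cong refl)
      fix a j assume "j \<in> indices (take n p)"
      then have "length j = n" using n by (auto dest: indices_length)
      then show "A n $$ (i ! n, a) * (kron_entry (map A [0..<n]) (take n i) j * X (j @ a # drop (Suc n) i))
        = kron_entry (map A [0..<Suc n]) (take (Suc n) i) (j @ [a]) * X ((j @ [a]) @ drop (Suc n) i)"
        using n li by (simp add: take_Suc_conv_app_nth kron_entry_append)
    qed
    \<comment> \<open>Mode \<open>n\<close> is the last mode of \<open>take (Suc n) p\<close>, so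
      isolating it makes the double sum over \<open>a\<close> and \<open>j\<close> a single sum over
      \<open>j @ [a]\<close>.\<close>
    also have "\<dots> = (\<Sum>j\<in>indices (take (Suc n) p). kron_entry (map A [0..<Suc n]) (take (Suc n) i) j
        * X (j @ drop (Suc n) i))"
    proof -
      have "del_mode n (take (Suc n) p) = take n p" "take (Suc n) p ! n = p ! n"
        using n by (simp_all add: del_mode_def)
      moreover have "ins_mode n a j = j @ [a]" if "j \<in> indices (take n p)" for a and j :: "nat list"
        using indices_length[OF that] n by (simp add: ins_mode_def)
      ultimately show ?thesis
        using n by (subst sum_indices_mode[of n]) (auto intro!: sum.cong)
    qed
    finally show ?thesis using True by simp
  qed
qed

lemma mode_prods_eq:
  assumes "X \<in> tensors p" "length q = length p"
    "\<And>l. l < length p \<Longrightarrow> A l \<in> carrier_mat (q ! l) (p ! l)"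
  shows "mode_prods p X A (length p) i = (if i \<in> indices q
    then \<Sum>j\<in>indices p. kron_entry (map A [0..<length p]) i j * X j else 0)"
  using mode_prods_upto[OF assms order_refl, of i] assms(2)
  by (auto dest: indices_length)

lemma mode_prods_in_tensors:
  assumes "X \<in> tensors p" "length q = length p"
    "\<And>l. l < length p \<Longrightarrow> A l \<in> carrier_mat (q ! l) (p ! l)"
  shows "mode_prods p X A (length p) \<in> tensors q"
  using mode_prods_eq[OF assms] by (simp add: tensors_def)

lemma mode_prods_cong:
  assumes "\<And>l. l < n \<Longrightarrow> A l = B l"
  shows "mode_prods p X A n = mode_prods p X B n"
  using assms
proof (induction n)
  case (Suc n)
  have "map (\<lambda>j. dim_row (A j)) [0..<n] = map (\<lambda>j. dim_row (B j)) [0..<n]" using Suc.prems by simp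
  moreover have "mode_prods p X A n = mode_prods p X B n" using Suc by simp
  ultimately show ?case using Suc.prems by (simp only: mode_prods.simps)
qed simp

section \<open>Matricizations of tensors and of mode products\<close>

lemma matricize_carrier [simp]: "matricize p k X \<in> carrier_mat (p ! k) (prod_list (del_mode k p))"
  by (simp add: matricize_def)

lemma matricize_dims [simp]:
  "dim_row (matricize p k X) = p ! k" "dim_col (matricize p k X) = prod_list (del_mode k p)"
  by (simp_all add: matricize_def)

lemma matricize_index:
  "a < p ! k \<Longrightarrow> c < prod_list (del_mode k p) \<Longrightarrow>
    matricize p k X $$ (a, c) = X (ins_mode k a (unflatten (del_mode k p) c))"
  by (simp add: matricize_def)

lemma matricize_tensorize:
  assumes "k < length p" "M \<in> carrier_mat (p ! k) (prod_list (del_mode k p))"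
  shows "matricize p k (tensorize p k M) = M"
proof (rule eq_matI)
  fix a c assume "a < dim_row M" "c < dim_col M"
  then have ac: "a < p ! k" "c < prod_list (del_mode k p)" using assms by auto
  have u: "unflatten (del_mode k p) c \<in> indices (del_mode k p)" by (rule unflatten_mem[OF ac(2)])
  then have "k \<le> length (unflatten (del_mode k p) c)"
    using indices_length[OF u] assms(1) by (simp add: length_del_mode)
  then show "matricize p k (tensorize p k M) $$ (a, c) = M $$ (a, c)"
    using ac assms(1) u ins_mode_mem[OF assms(1) ac(1) u]
    by (simp add: matricize_index tensorize_def del_mode_ins_mode flatten_unflatten)
qed (use assms in auto)

lemma tensorize_matricize:
  assumes "k < length p" "X \<in> tensors p"
  shows "tensorize p k (matricize p k X) = X"
proof
  fix i
  show "tensorize p k (matricize p k X) i = X i"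
  proof (cases "i \<in> indices p")
    case True
    have d: "del_mode k i \<in> indices (del_mode k p)" by (rule del_mode_mem[OF True])
    show ?thesis
      using True assms(1) d flatten_less[OF d] indices_nth[OF True assms(1)] indices_length[OF True]
      by (simp add: tensorize_def matricize_index unflatten_flatten ins_mode_del_mode)
  qed (use assms(2) in \<open>auto simp: tensorize_def tensors_def\<close>)
qed

text \<open>Matricization only rearranges entries, so each residual term can be estimated in the
  matricization of its own mode.\<close>

lemma tensor_norm_matricize:
  assumes "k < length p"
  shows "tensor_norm p X = frob_norm (matricize p k X)"
  unfolding tensor_norm_def frob_norm_def
  by (subst sum_indices_mode[OF assms]) (simp add: sum_indices_flat matricize_index)

lemma kron_entry_ins_mode:
  assumes "length i = length As - 1" "length j = length As - 1" "k < length As"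
  shows "kron_entry As (ins_mode k a i) (ins_mode k b j) = As ! k $$ (a, b) * kron_entry (del_mode k As) i j"
proof -
  have "kron_entry (take k As @ As ! k # drop (Suc k) As) (take k i @ a # drop k i) (take k j @ b # drop k j)
      = As ! k $$ (a, b) * (kron_entry (take k As) (take k i) (take k j) * kron_entry (drop (Suc k) As) (drop k i) (drop k j))"
    using assms by (subst kron_entry_append) auto
  also have "kron_entry (take k As) (take k i) (take k j) * kron_entry (drop (Suc k) As) (drop k i) (drop k j)
      = kron_entry (del_mode k As) i j"
    using assms kron_entry_append[of "take k i" "take k As" "take k j" "drop (Suc k) As" "drop k i" "drop k j"]
    by (simp add: del_mode_def)
  finally show ?thesis using assms(3) by (simp add: ins_mode_def id_take_nth_drop[symmetric])
qed

text \<open>In the closed form of the mode products, the coefficient splits into the entry of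
  \<open>A k\<close> and an entry of the Kronecker product over the remaining modes; the sum over
  mode \<open>k\<close> becomes left multiplication and the sum over the rest right
  multiplication.\<close>

theorem matricize_mode_prods:
  assumes X: "X \<in> tensors p" and len: "length q = length p" and k: "k < length p"
    and A: "\<And>l. l < length p \<Longrightarrow> A l \<in> carrier_mat (q ! l) (p ! l)"
  shows "matricize q k (mode_prods p X A (length p))
    = A k * matricize p k X * (kron_list (map A (rev (del_mode k [0..<length p]))))\<^sup>T"
proof -
  let ?As = "map A [0..<length p]"
  define Ds where "Ds = del_mode k ?As"
  let ?p = "del_mode k p" and ?q = "del_mode k q"
  have K: "kron_list (map A (rev (del_mode k [0..<length p]))) = kron_list (rev Ds)"
    by (simp add: Ds_def rev_map[symmetric] map_del_mode)
  have "map dim_row ?As = q" "map dim_col ?As = p"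
    using carrier_matD[OF A] len by (auto intro!: nth_equalityI)
  then have rows: "map dim_row Ds = ?q" and cols: "map dim_col Ds = ?p"
    unfolding Ds_def map_del_mode by simp_all
  have dims: "dim_row (kron_list (rev Ds)) = prod_list ?q" "dim_col (kron_list (rev Ds)) = prod_list ?p"
    by (simp_all add: rev_map[symmetric] rows cols)
  have lq: "length ?q = length p - 1" "length ?p = length p - 1"
    using k len by (auto simp: length_del_mode)
  have Ak: "A k \<in> carrier_mat (q ! k) (p ! k)" by (rule A[OF k])
  show ?thesis
    unfolding K
  proof (rule eq_matI)
    fix a c
    assume "a < dim_row (A k * matricize p k X * (kron_list (rev Ds))\<^sup>T)"
      "c < dim_col (A k * matricize p k X * (kron_list (rev Ds))\<^sup>T)"
    then have ac: "a < q ! k" "c < prod_list ?q" using Ak dims by auto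
    let ?i = "unflatten ?q c"
    have u: "?i \<in> indices ?q" by (rule unflatten_mem[OF ac(2)])
    have ins: "ins_mode k a ?i \<in> indices q" using ins_mode_mem[OF _ ac(1) u] k len by simp
    have "matricize q k (mode_prods p X A (length p)) $$ (a, c)
        = (\<Sum>j\<in>indices p. kron_entry ?As (ins_mode k a ?i) j * X j)"
      using ac ins by (simp add: matricize_index mode_prods_eq[OF X len A])
    also have "\<dots> = (\<Sum>b<p ! k. \<Sum>j\<in>indices ?p.
        kron_entry ?As (ins_mode k a ?i) (ins_mode k b j) * X (ins_mode k b j))"
      by (rule sum_indices_mode[OF k])
    also have "\<dots> = (\<Sum>b<p ! k. \<Sum>j\<in>indices ?p. A k $$ (a, b) * kron_entry Ds ?i j * X (ins_mode k b j))"
    proof (intro sum.cong refl)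
      fix b j assume "j \<in> indices ?p"
      then show "kron_entry ?As (ins_mode k a ?i) (ins_mode k b j) * X (ins_mode k b j)
          = A k $$ (a, b) * kron_entry Ds ?i j * X (ins_mode k b j)"
        using k lq indices_length[OF u] indices_length[of j ?p]
        by (subst kron_entry_ins_mode) (auto simp: Ds_def)
    qed
    also have "\<dots> = (\<Sum>b<p ! k. \<Sum>d<prod_list ?p.
        A k $$ (a, b) * kron_list (rev Ds) $$ (c, d) * matricize p k X $$ (b, d))"
      unfolding sum_indices_flat
    proof (intro sum.cong refl)
      fix b d assume bd: "b \<in> {..<p ! k}" "d \<in> {..<prod_list ?p}"
      have "kron_list (rev Ds) $$ (flatten ?q ?i, flatten ?p (unflatten ?p d)) = kron_entry Ds ?i (unflatten ?p d)"
        using kron_list_rev_entry[of ?i Ds "unflatten ?p d"] u unflatten_mem[of d ?p] bd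
        by (simp add: rows cols)
      then show "A k $$ (a, b) * kron_entry Ds ?i (unflatten ?p d) * X (ins_mode k b (unflatten ?p d))
          = A k $$ (a, b) * kron_list (rev Ds) $$ (c, d) * matricize p k X $$ (b, d)"
        using bd ac by (simp add: flatten_unflatten matricize_index)
    qed
    also have "\<dots> = (\<Sum>d<prod_list ?p. (\<Sum>b<p ! k. A k $$ (a, b) * matricize p k X $$ (b, d))
        * kron_list (rev Ds) $$ (c, d))"
      by (subst sum.swap) (simp add: sum_distrib_left mult_ac)
    also have "\<dots> = (A k * matricize p k X * (kron_list (rev Ds))\<^sup>T) $$ (a, c)"
      using ac Ak dims by (simp add: mult_mat_index del: index_mult_mat(1) kron_list_dims)
    finally show "matricize q k (mode_prods p X A (length p)) $$ (a, c)
        = (A k * matricize p k X * (kron_list (rev Ds))\<^sup>T) $$ (a, c)" .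
  qed (use Ak dims in \<open>auto simp del: kron_list_dims\<close>)
qed


section \<open>Projectors and the matrix bound\<close>

lemma proj_carrier [simp]: "proj U \<in> carrier_mat (dim_row U) (dim_row U)"
  by (auto simp: proj_def)

lemma proj_dims [simp]: "dim_row (proj U) = dim_row U" "dim_col (proj U) = dim_row U"
  by (auto simp: proj_def)

lemma proj_transpose: "(proj U)\<^sup>T = proj U"
  by (simp add: proj_def transpose_mult_dim)

lemma proj_mult_self:
  assumes "orthonormal_cols U"
  shows "proj U * U = U"
proof -
  have "proj U * U = U * (U\<^sup>T * U)" by (simp add: proj_def assoc_mult_mat_dim)
  then show ?thesis using assms by (simp add: orthonormal_cols_def)
qed

lemma proj_idem:
  assumes "orthonormal_cols U"
  shows "proj U * proj U = proj U"
proof -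
  have "proj U * proj U = (proj U * U) * U\<^sup>T"
    by (simp add: proj_def assoc_mult_mat_dim)
  then show ?thesis unfolding proj_mult_self[OF assms] by (simp add: proj_def)
qed

text \<open>\<open>Q * W = W\<close> places the range of \<open>W\<close> inside that of
  \<open>Q\<close>, so \<open>Q\<close> absorbs \<open>proj W\<close> from both sides. The
  difference projects onto the orthogonal complement of the range of \<open>W\<close> within the
  range of \<open>Q\<close>; with \<open>Q\<close> the identity it is
  \<open>proj_perp W\<close>.\<close>

lemma projection_diff:
  assumes Q: "Q \<in> carrier_mat n n" "Q\<^sup>T = Q" "Q * Q = Q"
    and W: "W \<in> carrier_mat n c" "orthonormal_cols W" "Q * W = W"
  shows "Q - proj W \<in> carrier_mat n n" "(Q - proj W)\<^sup>T = Q - proj W"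
    "(Q - proj W) * (Q - proj W) = Q - proj W"
proof -
  have P: "proj W \<in> carrier_mat n n" using W(1) by (metis carrier_matD(1) proj_carrier)
  show "Q - proj W \<in> carrier_mat n n" by (rule minus_carrier_mat[OF P])
  show "(Q - proj W)\<^sup>T = Q - proj W"
    using transpose_minus[OF Q(1) P] by (simp add: Q(2) proj_transpose)
  have QP: "Q * proj W = proj W"
    using Q(1) W(1) assoc_mult_mat_dim[of Q W "W\<^sup>T"] by (simp add: proj_def W(3))
  have "(Q * proj W)\<^sup>T = proj W * Q"
    using Q(1) P transpose_mult[OF Q(1) P] by (simp add: Q(2) proj_transpose)
  then have PQ: "proj W * Q = proj W" by (simp add: QP proj_transpose)
  have "(Q - proj W) * (Q - proj W) = Q * (Q - proj W) - proj W * (Q - proj W)"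
    by (rule minus_mult_distrib_mat[OF Q(1) P minus_carrier_mat[OF P]])
  also have "\<dots> = (Q - proj W) - (proj W - proj W)"
    unfolding mult_minus_distrib_mat[OF Q(1) Q(1) P] mult_minus_distrib_mat[OF P Q(1) P]
    by (simp only: Q(3) QP PQ proj_idem[OF W(2)])
  also have "\<dots> = Q - proj W"
    by (rule eq_matI) (use carrier_matD[OF Q(1)] carrier_matD[OF P] in auto)
  finally show "(Q - proj W) * (Q - proj W) = Q - proj W" .
qed

lemma proj_perp_projection:
  assumes "U \<in> carrier_mat n c" "orthonormal_cols U"
  shows "proj_perp U \<in> carrier_mat n n" "(proj_perp U)\<^sup>T = proj_perp U"
    "proj_perp U * proj_perp U = proj_perp U"
proof -
  have "proj_perp U = 1\<^sub>m n - proj U" using assms(1) by (simp add: proj_perp_def proj_def)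
  then show "proj_perp U \<in> carrier_mat n n" "(proj_perp U)\<^sup>T = proj_perp U"
    "proj_perp U * proj_perp U = proj_perp U"
    using projection_diff[of "1\<^sub>m n" n U c] assms by simp_all
qed

lemma proj_perp_mult_self:
  assumes "U \<in> carrier_mat n c" "orthonormal_cols U"
  shows "proj_perp U * U = 0\<^sub>m n c"
proof -
  have "proj_perp U * U = 1\<^sub>m n * U - proj U * U"
    using assms(1) minus_mult_distrib_mat[of "1\<^sub>m n" n n "U * U\<^sup>T" U c]
    by (simp add: proj_perp_def proj_def)
  then show ?thesis using assms(1) by (auto simp: proj_mult_self[OF assms(2)])
qed

lemma frob_norm_minus_commute:
  assumes "A \<in> carrier_mat m n" "B \<in> carrier_mat m n"
  shows "frob_norm (A - B) = frob_norm (B - A)"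
  using assms by (simp add: frob_norm_def power2_commute)

text \<open>The common core of the matrix and tensor bounds. A nonzero \<open>Z\<close> makes the
  divisor positive; the callers treat \<open>Z = 0\<close> separately.\<close>

theorem frob_norm_projected_le:
  fixes X Z :: "real mat"
  assumes X: "X \<in> carrier_mat m n" and Z: "Z \<in> carrier_mat m n" "Z \<noteq> 0\<^sub>m m n"
    and P: "P \<in> carrier_mat m m" "P\<^sup>T = P" "P * P = P" "P * X = 0\<^sub>m m n"
    and R: "R \<in> carrier_mat n n" "R\<^sup>T = R" "R * R = R" "X * R = 0\<^sub>m m n"
  shows "frob_norm (P * Z * R) \<le> (frob_norm (X - Z))\<^sup>2 / sing_val Z (mat_rank Z)"
proof -
  have D: "Z - X \<in> carrier_mat m n" using X Z by auto
  have "P * (Z - X) = P * Z - P * X" by (rule mult_minus_distrib_mat[OF P(1) Z(1) X])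
  also have "\<dots> = P * Z" unfolding P(4) by (rule eq_matI) (use P(1) Z(1) in auto)
  finally have PZ: "frob_norm (P * Z) \<le> frob_norm (X - Z)"
    using frob_norm_mult_projection_left[OF P(1-3), of "Z - X"] D X
    by (simp add: frob_norm_minus_commute[OF X Z(1)])
  have "(Z - X) * R = Z * R - X * R" by (rule minus_mult_distrib_mat[OF Z(1) X R(1)])
  also have "\<dots> = Z * R" unfolding R(4) by (rule eq_matI) (use R(1) Z(1) in auto)
  finally have ZR: "frob_norm (Z * R) \<le> frob_norm (X - Z)"
    using frob_norm_mult_projection_right[OF R(1-3), of "Z - X"] D X
    by (simp add: frob_norm_minus_commute[OF X Z(1)])
  have "frob_norm (P * Z * R) \<le> frob_norm (P * Z) * frob_norm (Z * R) / sing_val Z (mat_rank Z)"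
    by (rule frob_norm_two_sided[OF Z]) (use P(1) R(1) in auto)
  also have "\<dots> \<le> (frob_norm (X - Z))\<^sup>2 / sing_val Z (mat_rank Z)"
    unfolding power2_eq_square
    by (intro divide_right_mono mult_mono PZ ZR frob_norm_nonneg less_imp_le[OF sing_val_rank_pos[OF Z]])
  finally show ?thesis .
qed

text \<open>Every row of \<open>M\<close> is a combination of the columns of \<open>V\<close> and is
  therefore fixed by \<open>proj V\<close>, which by symmetry may act from the right.\<close>

lemma mult_proj_row_space:
  assumes M: "M \<in> carrier_mat a n" and V: "V \<in> carrier_mat n c" "orthonormal_cols V"
    and eq: "vec_space.col_space n V = vec_space.row_space n M"
  shows "M * proj V = M"
proof -
  interpret vec_space "TYPE(real)" n .
  have P: "proj V \<in> carrier_mat n n" using V(1) by (metis carrier_matD(1) proj_carrier)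
  have fix_row: "proj V *\<^sub>v row M i = row M i" if "i < a" for i
  proof -
    have "set (rows M) \<subseteq> carrier_vec n" using M by (auto simp: rows_def)
    then have "set (rows M) \<subseteq> row_space M" unfolding row_space_def by (rule in_own_span)
    then have "row M i \<in> row_space M" using that M by (auto simp: rows_def)
    then have "row M i \<in> col_space V" by (simp add: eq)
    then obtain x where x: "x \<in> carrier_vec c" "V *\<^sub>v x = row M i"
      using V(1) by (auto simp: col_space_eq[OF V(1)])
    have "proj V *\<^sub>v (V *\<^sub>v x) = (proj V * V) *\<^sub>v x"
      using assoc_mult_mat_vec[OF P V(1) x(1)] by simp
    then show ?thesis by (simp add: proj_mult_self[OF V(2)] x(2))
  qed
  show ?thesis
  proof (rule eq_matI)
    fix i j assume "i < dim_row M" "j < dim_col M"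
    then have ij: "i < a" "j < n" using M by auto
    have "(M * proj V) $$ (i, j) = row M i \<bullet> row ((proj V)\<^sup>T) j"
      using ij M V(1) by simp
    also have "\<dots> = (proj V *\<^sub>v row M i) $ j"
      unfolding proj_transpose
      using ij M V(1) P comm_scalar_prod[of "row M i" n "row (proj V) j"] by simp
    finally show "(M * proj V) $$ (i, j) = M $$ (i, j)" using ij M by (simp add: fix_row)
  qed (use M V(1) in auto)
qed

lemma mat_rank_zero: "mat_rank (0\<^sub>m m n) = 0"
  by (simp add: mat_rank_def vec_space.rank_0I)

lemma sing_val_zero_index: "sing_val A 0 = 0"
  by (simp add: sing_val_def)

text \<open>With \<open>a\<close>, \<open>b\<close>, \<open>c\<close> the projections of
  \<open>Z\<close> on the left, on the right and on both sides, the tangent projection is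
  \<open>a + b - c\<close>, and \<open>Z - a - b + c\<close> factors.\<close>

lemma mat_tangent_residual:
  assumes U: "U \<in> carrier_mat m r" and V: "V \<in> carrier_mat n r" and Z: "Z \<in> carrier_mat m n"
  shows "Z - mat_tangent_proj U V Z = proj_perp U * Z * proj_perp V"
proof -
  have PU: "proj U \<in> carrier_mat m m" and PV: "proj V \<in> carrier_mat n n"
    using U V by (metis carrier_matD(1) proj_carrier)+
  have perp: "proj_perp U = 1\<^sub>m m - proj U" "proj_perp V = 1\<^sub>m n - proj V"
    using U V by (auto simp: proj_perp_def proj_def)
  define a b c where "a = proj U * Z" and "b = Z * proj V" and "c = proj U * Z * proj V"
  have abc: "a \<in> carrier_mat m n" "b \<in> carrier_mat m n" "c \<in> carrier_mat m n"
    unfolding a_def b_def c_def using PU PV Z by (auto intro!: mult_carrier_mat)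
  have left: "proj_perp U * Z = Z - a"
    unfolding perp a_def using minus_mult_distrib_mat[OF one_carrier_mat PU Z] left_mult_one_mat[OF Z]
    by (simp only:)
  have right: "A * proj_perp V = A - A * proj V" if "A \<in> carrier_mat m n" for A
    unfolding perp using mult_minus_distrib_mat[OF that one_carrier_mat PV] right_mult_one_mat[OF that]
    by (simp only:)
  have mid: "(Z - a) * proj V = b - c"
    unfolding minus_mult_distrib_mat[OF Z abc(1) PV] by (simp only: a_def b_def c_def)
  have "proj_perp U * Z * proj_perp V = (Z - a) - (b - c)"
    unfolding left right[OF minus_carrier_mat[OF abc(1)]] mid ..
  moreover have "mat_tangent_proj U V Z = c + (b - c) + (a - c)"
    unfolding mat_tangent_proj_def left mid unfolding a_def[symmetric] right[OF abc(1)]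
    by (simp only: a_def c_def)
  moreover have "Z - (c + (b - c) + (a - c)) = (Z - a) - (b - c)"
    by (rule eq_matI) (use carrier_matD[OF Z] carrier_matD[OF abc(1)] carrier_matD[OF abc(2)]
        carrier_matD[OF abc(3)] in auto)
  ultimately show ?thesis by (simp only:)
qed

text \<open>\<open>Xt\<close> factors through \<open>U\<close> on the left and
  \<open>V\<^sup>T\<close> on the right, so the two complementary projectors annihilate it.\<close>

theorem matrix_tangent_bound:
  assumes Xt: "Xt \<in> carrier_mat m n" and Xs: "Xs \<in> carrier_mat m n"
    and svd: "economic_svd Xt r U V"
  shows "frob_norm (Xs - mat_tangent_proj U V Xs)
    \<le> (frob_norm (Xt - Xs))\<^sup>2 / sing_val Xs (mat_rank Xs)"
proof -
  have U: "U \<in> carrier_mat m r" "orthonormal_cols U" and V: "V \<in> carrier_mat n r" "orthonormal_cols V"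
    and X: "Xt = U * sing_diag Xt r * V\<^sup>T"
    using svd Xt by (auto simp: economic_svd_def)
  have S: "sing_diag Xt r \<in> carrier_mat r r" by (simp add: sing_diag_def)
  note PU = proj_perp_projection[OF U] and PV = proj_perp_projection[OF V]
  show ?thesis
    unfolding mat_tangent_residual[OF U(1) V(1) Xs]
  proof (cases "Xs = 0\<^sub>m m n")
    \<comment> \<open>The residual is 0, and so is the right side: the rank is 0,
      \<open>sing_val\<close> at 0 is 0, and division by 0 gives 0.\<close>
    case True
    have "proj_perp U * Xs * proj_perp V = 0\<^sub>m m n" using True PU(1) PV(1) by simp
    then show "frob_norm (proj_perp U * Xs * proj_perp V) \<le> (frob_norm (Xt - Xs))\<^sup>2 / sing_val Xs (mat_rank Xs)"
      by (simp add: True mat_rank_zero sing_val_zero_index frob_norm_def)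
  next
    case False
    have "proj_perp U * Xt = (proj_perp U * U) * (sing_diag Xt r * V\<^sup>T)"
      by (subst X) (use U(1) V(1) S PU(1) in \<open>simp add: assoc_mult_mat_dim\<close>)
    also have "\<dots> = 0\<^sub>m m n" unfolding proj_perp_mult_self[OF U] using S V(1) by simp
    finally have 1: "proj_perp U * Xt = 0\<^sub>m m n" .
    have "V\<^sup>T * proj_perp V = (proj_perp V * V)\<^sup>T"
      using V(1) PV(1,2) by (simp add: transpose_mult_dim)
    then have "V\<^sup>T * proj_perp V = 0\<^sub>m r n" by (simp add: proj_perp_mult_self[OF V])
    moreover have "Xt * proj_perp V = U * sing_diag Xt r * (V\<^sup>T * proj_perp V)"
      by (subst X) (use U(1) V(1) S PV(1) in \<open>simp add: assoc_mult_mat_dim\<close>)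
    ultimately have 2: "Xt * proj_perp V = 0\<^sub>m m n" using U(1) S by simp
    show "frob_norm (proj_perp U * Xs * proj_perp V) \<le> (frob_norm (Xt - Xs))\<^sup>2 / sing_val Xs (mat_rank Xs)"
      by (rule frob_norm_projected_le[OF Xt Xs False PU 1 PV 2])
  qed
qed


section \<open>The tensor bound\<close>

lemma tensor_norm_sum_le:
  "finite K \<Longrightarrow> tensor_norm p (\<lambda>i. \<Sum>k\<in>K. F k i) \<le> (\<Sum>k\<in>K. tensor_norm p (F k))"
proof (induction K rule: finite_induct)
  case empty
  then show ?case by (simp add: tensor_norm_def)
next
  case (insert k K)
  have "tensor_norm p (\<lambda>i. \<Sum>k\<in>insert k K. F k i)
      \<le> tensor_norm p (F k) + tensor_norm p (\<lambda>i. \<Sum>k\<in>K. F k i)"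
    using L2_set_triangle_ineq[of "F k" "\<lambda>i. \<Sum>k\<in>K. F k i" "indices p"] insert
    by (simp add: tensor_norm_def L2_set_def)
  then show ?case using insert by simp
qed

lemma tensorize_minus:
  assumes "k < length p" "B \<in> carrier_mat (p ! k) (prod_list (del_mode k p))"
  shows "tensorize p k (A - B) i = tensorize p k A i - tensorize p k B i"
  using assms indices_nth[of i p k] flatten_less[OF del_mode_mem[of i p k]]
  by (auto simp: tensorize_def)

section \<open>Projector identities for a fixed Tucker frame\<close>

locale tucker_frame_data =
  fixes p r :: "nat list" and Xt S :: tensor and U V :: "nat \<Rightarrow> real mat"
  assumes len: "length r = length p"
    and frame: "tucker_frame p r Xt S U V"
begin

lemma U: "k < length p \<Longrightarrow> U k \<in> carrier_mat (p ! k) (r ! k)" "k < length p \<Longrightarrow> orthonormal_cols (U k)"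
  using frame by (auto simp: tucker_frame_def leading_left_singular_def)

lemma S: "S \<in> tensors r" and Xt_eq: "Xt = mode_prods r S U (length r)"
  using frame len by (auto simp: tucker_frame_def)

lemma V:
  assumes "k < length p"
  shows "V k \<in> carrier_mat (prod_list (del_mode k r)) (r ! k)" "orthonormal_cols (V k)"
    "matricize r k S * proj (V k) = matricize r k S"
proof -
  have v: "V k \<in> carrier_mat (prod_list (del_mode k r)) (r ! k)" "orthonormal_cols (V k)"
    "vec_space.col_space (prod_list (del_mode k r)) (V k)
      = vec_space.row_space (prod_list (del_mode k r)) (matricize r k S)"
    using frame assms by (auto simp: tucker_frame_def Let_def)
  then show "V k \<in> carrier_mat (prod_list (del_mode k r)) (r ! k)" "orthonormal_cols (V k)" by auto
  show "matricize r k S * proj (V k) = matricize r k S"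
    by (rule mult_proj_row_space[OF matricize_carrier v])
qed

definition others :: "nat \<Rightarrow> nat list" where
  "others k = rev (del_mode k [0..<length p])"

definition K :: "nat \<Rightarrow> real mat" where
  "K k = kron_list (map U (others k))"

definition W :: "nat \<Rightarrow> real mat" where
  "W k = tangent_W (length p) U V k"

text \<open>Stage \<open>n\<close> of an interpolation from the identity in every mode, at
  \<open>n = 0\<close>, to the projector in every mode, at \<open>n = length p\<close>.\<close>

definition factor :: "nat \<Rightarrow> nat \<Rightarrow> real mat" where
  "factor n l = (if l < n then proj (U l) else 1\<^sub>m (p ! l))"

text \<open>The column action, in mode-\<open>k\<close> matricizations, of stages \<open>k\<close>
  and \<open>Suc k\<close> alike, since mode \<open>k\<close> is left out.\<close>

definition Q :: "nat \<Rightarrow> real mat" where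
  "Q k = kron_list (map (factor k) (others k))"

lemma W_eq: "W k = K k * V k"
  by (simp add: W_def tangent_W_def K_def others_def)

lemma othersD: "l \<in> set (others k) \<Longrightarrow> l < length p \<and> (k < length p \<longrightarrow> l \<noteq> k)"
  by (auto simp: others_def del_mode_def drop_upt dest: in_set_takeD in_set_dropD)

lemma prod_others:
  fixes q :: "nat list"
  assumes "length q = length p" "\<And>l. l < length p \<Longrightarrow> f l = q ! l"
  shows "prod_list (map f (others k)) = prod_list (del_mode k q)"
proof -
  have "map f [0..<length p] = q" using assms by (intro nth_equalityI) auto
  then have "map f (others k) = rev (del_mode k q)"
    by (simp add: others_def rev_map[symmetric] map_del_mode)
  then show ?thesis by (simp add: prod_list.rev)
qed

lemma K_carrier: "K k \<in> carrier_mat (prod_list (del_mode k p)) (prod_list (del_mode k r))"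
proof (rule carrier_matI)
  show "dim_row (K k) = prod_list (del_mode k p)" "dim_col (K k) = prod_list (del_mode k r)"
    unfolding K_def kron_list_dims map_map using U(1) len
    by (auto intro!: prod_others simp: o_def)
qed

lemma factor_carrier:
  "l < length p \<Longrightarrow> factor n l \<in> carrier_mat (p ! l) (p ! l)"
  using U(1)[of l] proj_carrier[of "U l"] by (auto simp: factor_def)

lemma factor_transpose: "(factor n l)\<^sup>T = factor n l"
  by (simp add: factor_def proj_transpose)

lemma Q_carrier: "Q k \<in> carrier_mat (prod_list (del_mode k p)) (prod_list (del_mode k p))"
proof (rule carrier_matI)
  show "dim_row (Q k) = prod_list (del_mode k p)" "dim_col (Q k) = prod_list (del_mode k p)"
    unfolding Q_def kron_list_dims map_map using carrier_matD[OF factor_carrier]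
    by (auto intro!: prod_others simp: o_def)
qed

lemma K_orthonormal: "(K k)\<^sup>T * K k = 1\<^sub>m (prod_list (del_mode k r))"
proof -
  have "(K k)\<^sup>T * K k = kron_list (map (\<lambda>l. (U l)\<^sup>T * U l) (others k))"
    unfolding K_def kron_list_transpose by (rule kron_list_mult) simp
  also have "map (\<lambda>l. (U l)\<^sup>T * U l) (others k) = map (\<lambda>l. 1\<^sub>m (r ! l)) (others k)"
    using U by (fastforce dest!: othersD simp: orthonormal_cols_def)
  finally show ?thesis
    unfolding kron_list_one using prod_others[of r "(!) r" k] len by simp
qed

lemma Q_symmetric: "(Q k)\<^sup>T = Q k"
  unfolding Q_def kron_list_transpose by (simp add: factor_transpose)

lemma Q_idem: "Q k * Q k = Q k"
proof -
  have "Q k * Q k = kron_list (map (\<lambda>l. factor k l * factor k l) (others k))"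
    unfolding Q_def using carrier_matD[OF factor_carrier] by (intro kron_list_mult) (auto dest: othersD)
  also have "map (\<lambda>l. factor k l * factor k l) (others k) = map (factor k) (others k)"
    using U(2) by (auto dest!: othersD simp: factor_def proj_idem)
  finally show ?thesis by (simp add: Q_def)
qed

text \<open>Each factor of \<open>Q k\<close> is \<open>proj (U l)\<close> or an identity, and both
  fix \<open>U l\<close>. Hence the range of \<open>K k\<close>, and with it that of
  \<open>W k\<close>, lies in the range of \<open>Q k\<close>.\<close>

lemma Q_mult_K: "Q k * K k = K k"
proof -
  have "Q k * K k = kron_list (map (\<lambda>l. factor k l * U l) (others k))"
    unfolding Q_def K_def using carrier_matD[OF factor_carrier] carrier_matD[OF U(1)]
    by (intro kron_list_mult) (auto dest: othersD)
  also have "map (\<lambda>l. factor k l * U l) (others k) = map U (others k)"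
    using U by (fastforce dest!: othersD simp: factor_def proj_mult_self)
  finally show ?thesis by (simp add: K_def)
qed

lemma W_carrier: "k < length p \<Longrightarrow> W k \<in> carrier_mat (prod_list (del_mode k p)) (r ! k)"
  unfolding W_eq using K_carrier V(1) by (rule mult_carrier_mat)

lemma W_orthonormal:
  assumes k: "k < length p"
  shows "orthonormal_cols (W k)"
proof -
  have "(W k)\<^sup>T * W k = (V k)\<^sup>T * ((K k)\<^sup>T * K k) * V k"
    using K_carrier[of k] V(1)[OF k] by (simp add: W_eq transpose_mult_dim assoc_mult_mat_dim)
  then show ?thesis
    using V(1,2)[OF k] unfolding K_orthonormal by (simp add: orthonormal_cols_def W_eq)
qed

lemma Q_mult_W: "k < length p \<Longrightarrow> Q k * W k = W k"
  using assoc_mult_mat[OF Q_carrier K_carrier V(1)] by (simp add: W_eq Q_mult_K)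

lemma matricize_Xt:
  assumes k: "k < length p"
  shows "matricize p k Xt = U k * matricize r k S * (K k)\<^sup>T"
  using matricize_mode_prods[OF S, of p k U] k len U(1)
  by (simp add: Xt_eq K_def others_def)

lemma perp_mult_Xt:
  assumes k: "k < length p"
  shows "proj_perp (U k) * matricize p k Xt = 0\<^sub>m (p ! k) (prod_list (del_mode k p))"
proof -
  have "proj_perp (U k) * matricize p k Xt
      = (proj_perp (U k) * U k) * (matricize r k S * (K k)\<^sup>T)"
    unfolding matricize_Xt[OF k]
    using U(1)[OF k] proj_perp_projection(1)[OF U[OF k]] K_carrier[of k]
    by (simp add: assoc_mult_mat_dim)
  then show ?thesis
    using K_carrier[of k] unfolding proj_perp_mult_self[OF U[OF k]]
    by (simp add: left_mult_zero_mat[of _ "r ! k" "prod_list (del_mode k p)"])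
qed

text \<open>Both projectors fix the rows of the matricization
  \<open>U k * matricize r k S * (K k)\<^sup>T\<close>: \<open>Q k\<close> fixes \<open>K k\<close>,
  while \<open>proj (W k)\<close> moves past \<open>(K k)\<^sup>T\<close> as
  \<open>proj (V k)\<close>, which the core absorbs.\<close>

lemma Xt_mult_residual:
  assumes k: "k < length p"
  shows "matricize p k Xt * (Q k - proj (W k)) = 0\<^sub>m (p ! k) (prod_list (del_mode k p))"
proof -
  let ?n = "prod_list (del_mode k p)"
  have PW: "proj (W k) \<in> carrier_mat ?n ?n"
    using W_carrier[OF k] by (metis carrier_matD(1) proj_carrier)
  have KQ: "(K k)\<^sup>T * Q k = (K k)\<^sup>T"
    using arg_cong[OF Q_mult_K[of k], of transpose_mat] transpose_mult[OF Q_carrier[of k] K_carrier[of k]]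
    by (simp add: Q_symmetric)
  have "(K k)\<^sup>T * proj (W k) = ((K k)\<^sup>T * K k) * (proj (V k) * (K k)\<^sup>T)"
    using K_carrier[of k] V(1)[OF k]
    by (simp add: proj_def W_eq transpose_mult_dim assoc_mult_mat_dim)
  also have "\<dots> = proj (V k) * (K k)\<^sup>T"
    unfolding K_orthonormal using V(1)[OF k] K_carrier[of k] by simp
  finally have "matricize r k S * ((K k)\<^sup>T * proj (W k)) = (matricize r k S * proj (V k)) * (K k)\<^sup>T"
    using K_carrier[of k] V(1)[OF k] by (simp add: assoc_mult_mat_dim)
  then have KW: "matricize r k S * ((K k)\<^sup>T * proj (W k)) = matricize r k S * (K k)\<^sup>T"
    by (simp add: V(3)[OF k])
  have "matricize p k Xt * Q k = U k * (matricize r k S * ((K k)\<^sup>T * Q k))"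
    "matricize p k Xt * proj (W k) = U k * (matricize r k S * ((K k)\<^sup>T * proj (W k)))"
    unfolding matricize_Xt[OF k]
    using U(1)[OF k] Q_carrier[of k] W_carrier[OF k] K_carrier[of k] by (simp_all add: assoc_mult_mat_dim)
  then have "matricize p k Xt * Q k = matricize p k Xt * proj (W k)" by (simp only: KQ KW)
  then have "matricize p k Xt * (Q k - proj (W k)) = matricize p k Xt * Q k - matricize p k Xt * Q k"
    using mult_minus_distrib_mat[OF matricize_carrier[of p k Xt] Q_carrier PW] by simp
  then show ?thesis
    using minus_r_inv_mat[OF mult_carrier_mat[OF matricize_carrier[of p k Xt] Q_carrier]] by (simp only:)
qed

section \<open>Partial projections and the telescoping sum\<close>

lemma matricize_partial:
  assumes Z: "Z \<in> tensors p" and k: "k < length p"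
  shows "matricize p k (mode_prods p Z (factor n) (length p))
    = factor n k * matricize p k Z * kron_list (map (factor n) (others k))"
proof -
  have "(kron_list (map (factor n) (others k)))\<^sup>T = kron_list (map (factor n) (others k))"
    unfolding kron_list_transpose by (simp add: factor_transpose)
  then show ?thesis
    using matricize_mode_prods[OF Z refl k factor_carrier] by (simp add: others_def)
qed

text \<open>A tensor is determined by its mode-0 matricization, on which identity factors act as
  identity matrices. A shape without modes has no such matricization, but then no product is
  taken.\<close>

lemma partial_0:
  assumes Z: "Z \<in> tensors p"
  shows "mode_prods p Z (factor 0) (length p) = Z"
proof (cases "length p = 0")
  case False
  then have k: "0 < length p" by simp
  have "factor 0 = (\<lambda>l. 1\<^sub>m (p ! l))" by (rule ext) (simp add: factor_def)
  then have "kron_list (map (factor 0) (others 0)) = 1\<^sub>m (prod_list (map ((!) p) (others 0)))"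
    by (simp add: kron_list_one)
  then have eq: "matricize p 0 (mode_prods p Z (factor 0) (length p)) = matricize p 0 Z"
    unfolding matricize_partial[OF Z k] using prod_others[of p "(!) p" 0] by (simp add: factor_def)
  have "mode_prods p Z (factor 0) (length p) \<in> tensors p"
    by (rule mode_prods_in_tensors[OF Z refl factor_carrier])
  from tensorize_matricize[OF k this] show ?thesis
    unfolding eq tensorize_matricize[OF k Z] by (rule sym)
qed simp

text \<open>The telescoping sum replaces the factors of \<open>Z\<close> by projections one mode at a time; each
  summand absorbs the matching summand of the tangent space projection.\<close>

lemma tangent_residual:
  assumes Z: "Z \<in> tensors p"
  shows "Z - tangent_proj p U V Z = (\<lambda>i. \<Sum>k<length p. tensorize p k
    (proj_perp (U k) * matricize p k Z * (Q k - proj (W k))) i)"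
proof
  fix i
  define D where "D n = mode_prods p Z (factor n) (length p)" for n
  define T where "T k = proj_perp (U k) * matricize p k Z * proj (W k)" for k
  have step: "D k i - D (Suc k) i - tensorize p k (T k) i
      = tensorize p k (proj_perp (U k) * matricize p k Z * (Q k - proj (W k))) i"
    if k: "k < length p" for k
  proof -
    let ?n = "prod_list (del_mode k p)" and ?Z = "matricize p k Z"
    have PW: "proj (W k) \<in> carrier_mat ?n ?n"
      using W_carrier[OF k] by (metis carrier_matD(1) proj_carrier)
    have PU: "proj (U k) \<in> carrier_mat (p ! k) (p ! k)"
      using U(1)[OF k] by (metis carrier_matD(1) proj_carrier)
    have perp: "proj_perp (U k) = 1\<^sub>m (p ! k) - proj (U k)"
      using U(1)[OF k] by (simp add: proj_perp_def proj_def)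
    have PZ: "proj_perp (U k) * ?Z \<in> carrier_mat (p ! k) ?n"
      using proj_perp_projection(1)[OF U[OF k]] by (rule mult_carrier_mat) simp
    \<comment> \<open>Stages \<open>k\<close> and \<open>Suc k\<close> differ only in mode
      \<open>k\<close>, which \<open>others k\<close> omits, so both share the right factor
      \<open>Q k\<close> and their difference produces \<open>proj_perp (U k)\<close> on the
      left.\<close>
    have same: "map (factor (Suc k)) (others k) = map (factor k) (others k)"
      using k by (auto simp: factor_def dest: othersD)
    have D: "matricize p k (D k) = ?Z * Q k" "matricize p k (D (Suc k)) = proj (U k) * ?Z * Q k"
      unfolding D_def matricize_partial[OF Z k] Q_def same by (simp_all add: factor_def)
    have "D n \<in> tensors p" for n
      unfolding D_def by (rule mode_prods_in_tensors[OF Z refl factor_carrier])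
    then have "tensorize p k (matricize p k (D n)) = D n" for n
      by (rule tensorize_matricize[OF k])
    from this[of k] this[of "Suc k"]
    have DT: "D k = tensorize p k (?Z * Q k)" "D (Suc k) = tensorize p k (proj (U k) * ?Z * Q k)"
      unfolding D by (simp_all only:)
    have "proj_perp (U k) * ?Z = ?Z - proj (U k) * ?Z"
      unfolding perp using minus_mult_distrib_mat[OF one_carrier_mat PU matricize_carrier] by simp
    then have "proj_perp (U k) * ?Z * Q k = ?Z * Q k - proj (U k) * ?Z * Q k"
      using minus_mult_distrib_mat[OF matricize_carrier mult_carrier_mat[OF PU matricize_carrier] Q_carrier]
      by simp
    then have eq: "proj_perp (U k) * ?Z * (Q k - proj (W k)) = ?Z * Q k - proj (U k) * ?Z * Q k - T k"
      using mult_minus_distrib_mat[OF PZ Q_carrier PW] by (simp add: T_def)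
    have carr: "?Z * Q k \<in> carrier_mat (p ! k) ?n" "proj (U k) * ?Z * Q k \<in> carrier_mat (p ! k) ?n"
        "T k \<in> carrier_mat (p ! k) ?n"
      unfolding T_def using PU PZ PW Q_carrier[of k] by (auto intro!: mult_carrier_mat)
    show ?thesis
      unfolding eq DT by (simp only: tensorize_minus carr minus_carrier_mat[OF carr(2)] k)
  qed
  \<comment> \<open>Stage 0 is \<open>Z\<close> and stage \<open>length p\<close> is the first
    summand of the tangent projection; their difference telescopes, and the terms \<open>T k\<close>
    form the remaining summands.\<close>
  have "mode_prods p Z (\<lambda>k. proj (U k)) (length p) = D (length p)"
    unfolding D_def by (rule mode_prods_cong) (simp add: factor_def)
  then have "(Z - tangent_proj p U V Z) i = D 0 i - D (length p) i - (\<Sum>k<length p. tensorize p k (T k) i)"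
    by (simp add: tangent_proj_def T_def W_def D_def partial_0[OF Z])
  also have "\<dots> = (\<Sum>k<length p. D k i - D (Suc k) i - tensorize p k (T k) i)"
    unfolding sum_subtractf[of _ "\<lambda>k. tensorize p k (T k) i"]
      sum_lessThan_telescope'[of "\<lambda>k. D k i"] ..
  also have "\<dots> = (\<Sum>k<length p. tensorize p k (proj_perp (U k) * matricize p k Z * (Q k - proj (W k))) i)"
    by (intro sum.cong) (auto simp: step)
  finally show "(Z - tangent_proj p U V Z) i
    = (\<Sum>k<length p. tensorize p k (proj_perp (U k) * matricize p k Z * (Q k - proj (W k))) i)" .
qed

lemma residual_term_bound:
  assumes k: "k < length p" and Z: "matricize p k Z \<noteq> 0\<^sub>m (p ! k) (prod_list (del_mode k p))"
  shows "tensor_norm p (tensorize p k (proj_perp (U k) * matricize p k Z * (Q k - proj (W k))))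
    \<le> (tensor_norm p (Xt - Z))\<^sup>2 / sing_val (matricize p k Z) (mat_rank (matricize p k Z))"
proof -
  note P = proj_perp_projection[OF U[OF k]]
  note R = projection_diff[OF Q_carrier Q_symmetric Q_idem W_carrier[OF k] W_orthonormal[OF k] Q_mult_W[OF k]]
  let ?M = "proj_perp (U k) * matricize p k Z * (Q k - proj (W k))"
  have "?M \<in> carrier_mat (p ! k) (prod_list (del_mode k p))"
    by (rule mult_carrier_mat[OF mult_carrier_mat[OF P(1) matricize_carrier] R(1)])
  then have "tensor_norm p (tensorize p k ?M) = frob_norm ?M"
    using tensor_norm_matricize[OF k] matricize_tensorize[OF k] by simp
  also have "\<dots> \<le> (frob_norm (matricize p k Xt - matricize p k Z))\<^sup>2
      / sing_val (matricize p k Z) (mat_rank (matricize p k Z))"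
    by (rule frob_norm_projected_le[OF matricize_carrier matricize_carrier Z P perp_mult_Xt[OF k]
          R Xt_mult_residual[OF k]])
  also have "matricize p k Xt - matricize p k Z = matricize p k (Xt - Z)"
    by (rule eq_matI) (auto simp: matricize_index)
  finally show ?thesis unfolding tensor_norm_matricize[OF k, symmetric] .
qed

theorem tensor_tangent_bound:
  assumes Z: "Z \<in> tensors p"
  shows "tensor_norm p (Z - tangent_proj p U V Z) \<le> real (length p) * (tensor_norm p (Xt - Z))\<^sup>2
    / Min ((\<lambda>k. sing_val (matricize p k Z) (mat_rank (matricize p k Z))) ` {..<length p})"
proof (cases "length p = 0")
  \<comment> \<open>Without modes the minimum is over the empty set, but the factor
    \<open>real (length p)\<close> makes the right side 0, and the residual is an empty sum.\<close>
  case True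
  then show ?thesis unfolding tangent_residual[OF Z] by (simp add: tensor_norm_def)
next
  case N: False
  let ?s = "\<lambda>k. sing_val (matricize p k Z) (mat_rank (matricize p k Z))"
  let ?M = "Min (?s ` {..<length p})"
  show ?thesis
  proof (cases "\<exists>k<length p. matricize p k Z = 0\<^sub>m (p ! k) (prod_list (del_mode k p))")
    \<comment> \<open>One zero matricization forces \<open>Z = 0\<close> and hence all of them to be
      zero. The minimum is then the default value 0, the quotient is 0, and the residual vanishes
      term by term.\<close>
    case True
    then obtain k where k: "k < length p" "matricize p k Z = 0\<^sub>m (p ! k) (prod_list (del_mode k p))"
      by blast
    have "tensorize p k (0\<^sub>m (p ! k) (prod_list (del_mode k p))) = (\<lambda>_. 0)"
      using k(1) flatten_less[OF del_mode_mem] by (auto simp: tensorize_def fun_eq_iff indices_nth)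
    then have "Z = (\<lambda>_. 0)" using tensorize_matricize[OF k(1) Z] k(2) by simp
    then have zero: "matricize p l Z = 0\<^sub>m (p ! l) (prod_list (del_mode l p))" for l
      by (intro eq_matI) (auto simp: matricize_index)
    have "tensor_norm p (tensorize p l (proj_perp (U l) * matricize p l Z * (Q l - proj (W l)))) = 0"
      if l: "l < length p" for l
    proof -
      let ?O = "0\<^sub>m (p ! l) (prod_list (del_mode l p)) :: real mat"
      have R: "Q l - proj (W l) \<in> carrier_mat (prod_list (del_mode l p)) (prod_list (del_mode l p))"
        by (rule projection_diff[OF Q_carrier Q_symmetric Q_idem W_carrier[OF l] W_orthonormal[OF l] Q_mult_W[OF l]])
      have "proj_perp (U l) * matricize p l Z * (Q l - proj (W l)) = ?O"
        unfolding zero using proj_perp_projection(1)[OF U[OF l]] left_mult_zero_mat[OF R] by simp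
      then show ?thesis
        using tensor_norm_matricize[OF l] matricize_tensorize[OF l, of ?O] by (simp add: frob_norm_def)
    qed
    then have "tensor_norm p (Z - tangent_proj p U V Z) \<le> 0"
      unfolding tangent_residual[OF Z] by (intro order_trans[OF tensor_norm_sum_le]) auto
    moreover have "?M = 0"
      using N by (simp add: zero mat_rank_zero sing_val_zero_index image_constant_conv lessThan_empty_iff)
    ultimately show ?thesis by simp
  next
    case False
    then have pos: "0 < ?s k" if "k < length p" for k
      using sing_val_rank_pos[OF matricize_carrier] that by blast
    have M: "0 < ?M" using N pos by (subst Min_gr_iff) auto
    have le: "?M \<le> ?s k" if "k < length p" for k using that by (intro Min_le) auto
    have "tensor_norm p (Z - tangent_proj p U V Z) \<le> (\<Sum>k<length p. tensor_norm p
        (tensorize p k (proj_perp (U k) * matricize p k Z * (Q k - proj (W k)))))"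
      unfolding tangent_residual[OF Z] by (rule tensor_norm_sum_le) simp
    also have "\<dots> \<le> (\<Sum>k<length p. (tensor_norm p (Xt - Z))\<^sup>2 / ?M)"
    proof (rule sum_mono)
      fix k assume "k \<in> {..<length p}"
      then have k: "k < length p" by simp
      have "(tensor_norm p (Xt - Z))\<^sup>2 / ?s k \<le> (tensor_norm p (Xt - Z))\<^sup>2 / ?M"
        by (rule divide_left_mono[OF le[OF k]]) (use M pos[OF k] in auto)
      then show "tensor_norm p (tensorize p k (proj_perp (U k) * matricize p k Z * (Q k - proj (W k))))
          \<le> (tensor_norm p (Xt - Z))\<^sup>2 / ?M"
        using residual_term_bound[OF k, of Z] False k by fastforce
    qed
    finally show ?thesis by simp
  qed
qed

end

theorem lemma3:
  shows
    "(\<forall>(d::nat) (m::nat) (N::nat) (p::nat list) (r::nat list) (rs::nat list)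
        (Xt::tensor) (Xs::tensor) (S::tensor) (U::nat \<Rightarrow> real mat) (V::nat \<Rightarrow> real mat).
        N = d + m \<longrightarrow> length p = N \<longrightarrow>
        Xt \<in> tensors p \<longrightarrow> tucker_rank p Xt = r \<longrightarrow>
        Xs \<in> tensors p \<longrightarrow> tucker_rank p Xs = rs \<longrightarrow>
        list_all2 (\<le>) rs r \<longrightarrow>
        tucker_frame p r Xt S U V \<longrightarrow>
        tensor_norm p (Xs - tangent_proj p U V Xs)
          \<le> 2 * real N * (tensor_norm p (Xt - Xs))\<^sup>2
            / Min ((\<lambda>k. sing_val (matricize p k Xs) (rs ! k)) ` {..<N}))
     \<and>
     (\<forall>(p1::nat) (p2::nat) (r::nat) (rs::nat) (Xt::real mat) (Xs::real mat)
        (U::real mat) (V::real mat).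
        Xt \<in> carrier_mat p1 p2 \<longrightarrow> mat_rank Xt = r \<longrightarrow>
        Xs \<in> carrier_mat p1 p2 \<longrightarrow> mat_rank Xs = rs \<longrightarrow>
        rs \<le> r \<longrightarrow>
        economic_svd Xt r U V \<longrightarrow>
        frob_norm (Xs - mat_tangent_proj U V Xs)
          \<le> 2 * (frob_norm (Xt - Xs))\<^sup>2 / sing_val Xs rs)"
proof (intro conjI allI impI)
  fix d m N p r rs Xt Xs S U V
  assume N: "length p = N" and Xt: "tucker_rank p Xt = r" and Xs: "Xs \<in> tensors p" "tucker_rank p Xs = rs"
    and fr: "tucker_frame p r Xt S U V"
  interpret tucker_frame_data p r Xt S U V
    using Xt fr by unfold_locales (auto simp: tucker_rank_def)
  have "(\<lambda>k. sing_val (matricize p k Xs) (rs ! k)) ` {..<N}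
      = (\<lambda>k. sing_val (matricize p k Xs) (mat_rank (matricize p k Xs))) ` {..<N}"
    using Xs(2) N by (intro image_cong) (auto simp: tucker_rank_def)
  then have bound: "tensor_norm p (Xs - tangent_proj p U V Xs) \<le> real N * (tensor_norm p (Xt - Xs))\<^sup>2
      / Min ((\<lambda>k. sing_val (matricize p k Xs) (rs ! k)) ` {..<N})"
    using tensor_tangent_bound[OF Xs(1)] N by simp
  \<comment> \<open>The bound is already available with constant \<open>N\<close>. Its right side
    dominates a norm and is therefore nonnegative, so doubling it preserves the inequality.\<close>
  moreover have "0 \<le> tensor_norm p (Xs - tangent_proj p U V Xs)"
    by (simp add: tensor_norm_def sum_nonneg)
  ultimately show "tensor_norm p (Xs - tangent_proj p U V Xs)
      \<le> 2 * real N * (tensor_norm p (Xt - Xs))\<^sup>2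
        / Min ((\<lambda>k. sing_val (matricize p k Xs) (rs ! k)) ` {..<N})"
    by simp
next
  fix p1 p2 r rs :: nat and Xt Xs U V
  assume "Xt \<in> carrier_mat p1 p2" "Xs \<in> carrier_mat p1 p2" "mat_rank Xs = rs" "economic_svd Xt r U V"
  then have "frob_norm (Xs - mat_tangent_proj U V Xs) \<le> (frob_norm (Xt - Xs))\<^sup>2 / sing_val Xs rs"
    using matrix_tangent_bound by blast
  \<comment> \<open>Here the constant 1 has been obtained, and the same nonnegativity argument
    passes to 2.\<close>
  then show "frob_norm (Xs - mat_tangent_proj U V Xs) \<le> 2 * (frob_norm (Xt - Xs))\<^sup>2 / sing_val Xs rs"
    using frob_norm_nonneg[of "Xs - mat_tangent_proj U V Xs"] by simp
qed

end
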